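(* Let $X$ be a Banach space. Then $X$ is sequentially reflexive if and only if $\ell_1$ is not isomorphic to a subspace of $X$.
   Context: For a Banach space $X$ with dual $X^*$, the Mackey topology $\tau(X^*,X)$ is the topology on $X^*$ of uniform convergence on weakly compact absolutely convex subsets of $X$. A Banach space $X$ is called sequentially reflexive if every sequence in $X^*$ that converges in the Mackey topology $\tau(X^*,X)$ converges in the norm topology of $X^*$. "Isomorphic" means linearly homeomorphic (not necessarily isometric), so "$\ell_1$ is isomorphic to a subspace of $X$" means that there is a bounded linear operator $\ell_1 \to X$ that is a linear homeomorphism onto its image. Here $\ell_1$ is the Banach space of absolutely summable scalar sequences with its usual norm. *)

theory Defs
  imports "HOL-Analysis.Analysis"
begin

text \<open>
  Real and complex Banach spaces are treated together. The library class \<open>banach\<close> only carries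
  real scalars; a complex Banach space is a type of that class together with a complex scalar
  multiplication satisfying the locale below. For real scalars the first axiom leaves
  only \<open>scaleR\<close>.
\<close>

locale normed_space_over = vector_space scl
  for scl :: "'k::real_normed_field \<Rightarrow> 'a::real_normed_vector \<Rightarrow> 'a" +
  assumes scl_of_real: "scl (of_real r) x = r *\<^sub>R x"
    and norm_scl: "norm (scl c x) = norm c * norm x"

text \<open>
  The norm inherited from the type of bounded real-linear maps is the operator norm,
  that is, the dual norm. If \<open>scl\<close> is \<open>scaleR\<close>, the dual is the whole type.
\<close>

definition dual ::
    "('k::real_normed_field \<Rightarrow> 'a::real_normed_vector \<Rightarrow> 'a) \<Rightarrow> ('a \<Rightarrow>\<^sub>L 'k) set" where
  "dual scl = {f. \<forall>c x. blinfun_apply f (scl c x) = c * blinfun_apply f x}"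

definition weak_topology ::
    "('k::real_normed_field \<Rightarrow> 'a::real_normed_vector \<Rightarrow> 'a) \<Rightarrow> 'a topology" where
  "weak_topology scl =
     topology_generated_by {blinfun_apply f -` U | f U. f \<in> dual scl \<and> open U}"

definition absolutely_convex ::
    "('k::real_normed_field \<Rightarrow> 'a::real_normed_vector \<Rightarrow> 'a) \<Rightarrow> 'a set \<Rightarrow> bool" where
  "absolutely_convex scl K \<longleftrightarrow>
     (\<forall>x\<in>K. \<forall>y\<in>K. \<forall>a b. norm a + norm b \<le> 1 \<longrightarrow> scl a x + scl b y \<in> K)"

text \<open>
  Since \<open>K\<close> is weakly compact, the pointwise strict bound on \<open>K\<close> in the generating sets
  says the same as the strict bound on the supremum over a nonempty \<open>K\<close>.
\<close>

definition mackey_topology ::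
    "('k::real_normed_field \<Rightarrow> 'a::real_normed_vector \<Rightarrow> 'a) \<Rightarrow> ('a \<Rightarrow>\<^sub>L 'k) topology" where
  "mackey_topology scl =
     topology_generated_by
       {{g \<in> dual scl. \<forall>x\<in>K. norm (blinfun_apply g x - blinfun_apply f x) < e} | f K e.
          f \<in> dual scl \<and> compactin (weak_topology scl) K \<and> absolutely_convex scl K \<and> 0 < e}"

definition sequentially_reflexive ::
    "('k::real_normed_field \<Rightarrow> 'a::real_normed_vector \<Rightarrow> 'a) \<Rightarrow> bool" where
  "sequentially_reflexive scl \<longleftrightarrow>
     (\<forall>\<phi> :: nat \<Rightarrow> ('a \<Rightarrow>\<^sub>L 'k). range \<phi> \<subseteq> dual scl \<longrightarrow>
        (\<exists>f. limitin (mackey_topology scl) \<phi> f sequentially) \<longrightarrow>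
        (\<exists>g\<in>dual scl. \<phi> \<longlonglongrightarrow> g))"

typedef (overloaded) 'k l1 = "{a :: nat \<Rightarrow> 'k::real_normed_vector. summable (\<lambda>n. norm (a n))}"
  morphisms l1_nth Abs_l1
  by (rule exI[of _ "\<lambda>_. 0"]) simp

setup_lifting type_definition_l1

lemma summable_l1: "summable (\<lambda>n. norm (l1_nth a n))"
  using l1_nth[of a] by simp

instantiation l1 :: (real_normed_vector) real_normed_vector
begin

lift_definition zero_l1 :: "'a l1" is "\<lambda>_. 0"
  by simp

lift_definition plus_l1 :: "'a l1 \<Rightarrow> 'a l1 \<Rightarrow> 'a l1" is "\<lambda>a b n. a n + b n"
proof -
  fix a b :: "nat \<Rightarrow> 'a"
  assume *: "summable (\<lambda>n. norm (a n))" "summable (\<lambda>n. norm (b n))"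
  show "summable (\<lambda>n. norm (a n + b n))"
    by (rule summable_comparison_test'[OF summable_add[OF *]]) (auto intro: norm_triangle_ineq)
qed

lift_definition uminus_l1 :: "'a l1 \<Rightarrow> 'a l1" is "\<lambda>a n. - a n"
  by simp

lift_definition minus_l1 :: "'a l1 \<Rightarrow> 'a l1 \<Rightarrow> 'a l1" is "\<lambda>a b n. a n - b n"
proof -
  fix a b :: "nat \<Rightarrow> 'a"
  assume *: "summable (\<lambda>n. norm (a n))" "summable (\<lambda>n. norm (b n))"
  show "summable (\<lambda>n. norm (a n - b n))"
    by (rule summable_comparison_test'[OF summable_add[OF *]]) (auto intro: norm_triangle_ineq4)
qed

lift_definition scaleR_l1 :: "real \<Rightarrow> 'a l1 \<Rightarrow> 'a l1" is "\<lambda>r a n. r *\<^sub>R a n"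
  by simp

lift_definition norm_l1 :: "'a l1 \<Rightarrow> real" is "\<lambda>a. \<Sum>n. norm (a n)" .

definition sgn_l1 :: "'a l1 \<Rightarrow> 'a l1" where
  "sgn_l1 a = inverse (norm a) *\<^sub>R a"

definition dist_l1 :: "'a l1 \<Rightarrow> 'a l1 \<Rightarrow> real" where
  "dist_l1 a b = norm (a - b)"

definition uniformity_l1 :: "('a l1 \<times> 'a l1) filter" where
  "uniformity_l1 = (INF e\<in>{0<..}. principal {(a, b). dist a b < e})"

definition open_l1 :: "'a l1 set \<Rightarrow> bool" where
  "open_l1 U \<longleftrightarrow> (\<forall>a\<in>U. eventually (\<lambda>(a', b). a' = a \<longrightarrow> b \<in> U) uniformity)"

instance
proof
  fix a b c :: "'a l1" and r s :: real
  show "norm a = 0 \<longleftrightarrow> a = 0"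
  proof transfer
    fix a :: "nat \<Rightarrow> 'a"
    assume "summable (\<lambda>n. norm (a n))"
    then show "(\<Sum>n. norm (a n)) = 0 \<longleftrightarrow> a = (\<lambda>_. 0)"
      by (subst suminf_eq_zero_iff) (auto simp: fun_eq_iff)
  qed
  show "norm (a + b) \<le> norm a + norm b"
  proof transfer
    fix a b :: "nat \<Rightarrow> 'a"
    assume *: "summable (\<lambda>n. norm (a n))" "summable (\<lambda>n. norm (b n))"
    have "summable (\<lambda>n. norm (a n + b n))"
      by (rule summable_comparison_test'[OF summable_add[OF *]]) (auto intro: norm_triangle_ineq)
    then have "(\<Sum>n. norm (a n + b n)) \<le> (\<Sum>n. norm (a n) + norm (b n))"
      using * by (intro suminf_le summable_add) (auto intro: norm_triangle_ineq)
    then show "(\<Sum>n. norm (a n + b n)) \<le> (\<Sum>n. norm (a n)) + (\<Sum>n. norm (b n))"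
      using suminf_add[OF *] by simp
  qed
  show "norm (r *\<^sub>R a) = \<bar>r\<bar> * norm a"
    by transfer (simp add: suminf_mult)
  show "a + b + c = a + (b + c)"
    by transfer (simp add: add.assoc)
  show "a + b = b + a"
    by transfer (simp add: add.commute)
  show "0 + a = a"
    by transfer simp
  show "- a + a = 0"
    by transfer simp
  show "a - b = a + - b"
    by transfer simp
  show "r *\<^sub>R (a + b) = r *\<^sub>R a + r *\<^sub>R b"
    by transfer (simp add: scaleR_add_right)
  show "(r + s) *\<^sub>R a = r *\<^sub>R a + s *\<^sub>R a"
    by transfer (simp add: scaleR_add_left)
  show "r *\<^sub>R s *\<^sub>R a = (r * s) *\<^sub>R a"
    by transfer simp
  show "1 *\<^sub>R a = a"
    by transfer simp
qed (simp_all only: sgn_l1_def dist_l1_def uniformity_l1_def open_l1_def)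

end

lift_definition scale_l1 :: "'k::real_normed_field \<Rightarrow> 'k l1 \<Rightarrow> 'k l1" is "\<lambda>c a n. c * a n"
  by (simp add: norm_mult summable_mult)

definition l1_isomorphic_to_subspace ::
    "('k::real_normed_field \<Rightarrow> 'a::real_normed_vector \<Rightarrow> 'a) \<Rightarrow> bool" where
  "l1_isomorphic_to_subspace scl \<longleftrightarrow>
     (\<exists>T :: 'k l1 \<Rightarrow> 'a. bounded_linear T \<and> (\<forall>c a. T (scale_l1 c a) = scl c (T a)) \<and>
        (\<exists>S. homeomorphism UNIV (range T) T S))"

end

theory Submission
  imports Defs "HOL-Library.Diagonal_Subsequence"
begin

text \<open>
  All of the work is done for scalars in a real normed field that is also a Euclidean space. Such a field
  carries an abstract conjugation, defined by moving a factor to the other side of the inner product, and the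
  real part of a scalar is its inner product with 1. This covers the real and the complex numbers in one
  argument.

  Suppose first that the space contains no copy of \<open>l1\<close>, and let \<open>g n = \<phi> n -
  f\<close> tend to zero in the Mackey topology but not in norm. Choose vectors \<open>x n\<close> of norm at
  most 1 at which \<open>g n\<close> is bounded below. By the theorem of Rosenthal and Dor
  (\<open>rosenthal_dor\<close>) a subsequence of \<open>x\<close> is weakly Cauchy, so the differences
  \<open>y k\<close> of consecutive members of any further subsequence are weakly null. Since \<open>g
  n\<close> tends to zero at every point, that subsequence can be taken so sparse that the functional
  belonging to the later vector of each difference is small at the earlier one. These functionals stay bounded
  below on the \<open>y k\<close>. This contradicts uniform convergence on weakly compact sets: the vectors
  \<open>\<Sum>k. a k * y k\<close> with \<open>\<Sum>k. \<bar>a k\<bar> \<le> 1\<close> form a weakly compact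
  absolutely convex set (\<open>weakly_null_hull\<close>), the image of the unit ball of \<open>l1\<close>,
  compact in the product topology, under a map that is continuous because \<open>y\<close> is weakly null.

  Suppose conversely that \<open>u n\<close> are the images of the unit vectors under an embedding of
  \<open>l1\<close>. Every sequence \<open>E\<close> of signs is the sequence of values at the \<open>u
  n\<close> of a functional \<open>\<phi> E\<close> on the whole space, with norms bounded independently of
  \<open>E\<close>. The Rademacher coefficients of \<open>E \<mapsto> \<phi> E x\<close>, as functions of
  \<open>x\<close>, are functionals \<open>coeff n\<close> with value 1 at \<open>u n\<close>, hence not norm
  null. They tend to zero pointwise by Bessel's inequality. They also tend to zero uniformly on weakly compact
  sets, which is the Dunford-Pettis property in disguise: along a weakly null sequence \<open>y\<close> the
  functions \<open>E \<mapsto> \<phi> E (y k)\<close> are uniformly bounded and tend to zero in mean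
  (\<open>coeff_weakly_null\<close>), and by the easy half of the Eberlein-Smulian theorem
  (\<open>weakly_compact_imp_sequentially_compact\<close>) weakly null sequences are all that has to be
  considered.

  No measure on sign sequences is used. The averages run over finite cubes and are passed to the limit along a
  free ultrafilter, so \<open>E \<mapsto> \<phi> E x\<close> may be as irregular as the axiom of choice makes
  it. What replaces dominated convergence is \<open>subsequence_with_finite_intersections\<close>: sets whose
  finitely additive mean is bounded below have a subsequence with the finite intersection property. If
  \<open>\<bar>\<phi> E (y k)\<bar>\<close> were large on a set of signs \<open>E\<close> of mean bounded
  below for every \<open>k\<close>, then along a subsequence every finite number of these conditions would
  hold for a common functional, and a limit of such functionals would be one along which \<open>y\<close> is
  not null.

  The theorem of Rosenthal and Dor follows from a Ramsey theorem for infinite sequences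
  (\<open>nash_williams\<close>), applied to the values at \<open>x n\<close> of the functionals in the dual
  ball.
\<close>

section \<open>Subsequences and ultrafilters\<close>

text \<open>
  The condition on the next member may refer to the set of all earlier members, and through the
  cardinality of that set to the position of the next member.
\<close>

lemma greedy_subsequence:
  fixes Q :: "nat set \<Rightarrow> nat \<Rightarrow> bool"
  assumes "\<And>F. finite F \<Longrightarrow> \<exists>\<^sub>\<infinity>n. Q F n"
  obtains l :: "nat \<Rightarrow> nat" where "strict_mono l" "\<And>n. Q (l ` {..<n}) (l n)"
proof -
  have "\<exists>n. Q F n \<and> (\<forall>m\<in>F. m < n)" if F: "finite F" for F
  proof -
    obtain n where "n > Max (insert 0 F)" "Q F n"
      using assms[OF F] by (auto simp: INFM_nat)
    moreover have "m \<le> Max (insert 0 F)" if "m \<in> F" for m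
      using that F by auto
    ultimately show ?thesis
      by (meson order.strict_trans1)
  qed
  then obtain g where g: "\<And>F. finite F \<Longrightarrow> Q F (g F) \<and> (\<forall>m\<in>F. m < g F)"
    by metis
  define Fs where "Fs = rec_nat {} (\<lambda>_ F. insert (g F) F)"
  define l where "l n = g (Fs n)" for n
  have Fs: "Fs n = l ` {..<n}" for n
    by (induction n) (auto simp: Fs_def l_def lessThan_Suc)
  then have fin: "finite (Fs n)" for n by simp
  show thesis
  proof (rule that)
    have *: "Q (l ` {..<n}) (l n) \<and> (\<forall>m\<in>l ` {..<n}. m < l n)" for n
      using g[OF fin[of n], folded l_def] unfolding Fs .
    then show "strict_mono l"
      by (simp add: strict_mono_def)
    from * show "Q (l ` {..<n}) (l n)" for n
      by blast
  qed
qed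

definition free_ultrafilter :: "nat filter \<Rightarrow> bool" where
  "free_ultrafilter U \<longleftrightarrow> U \<noteq> bot \<and> U \<le> sequentially \<and>
     (\<forall>P. eventually P U \<or> eventually (\<lambda>n. \<not> P n) U)"

lemma free_ultrafilter_exists: "\<exists>U. free_ultrafilter U"
proof -
  define A where "A = {F :: nat filter. F \<noteq> bot \<and> F \<le> sequentially}"
  have "\<exists>m\<in>A. \<forall>a\<in>A. m \<ge> a \<longrightarrow> a = m"
  proof (rule predicate_Zorn)
    show "partial_order_on A (relation_of (\<ge>) A)"
      by (rule partial_order_on_relation_ofI) auto
  next
    fix C assume C: "C \<in> Chains (relation_of (\<ge>) A)"
    then have CA: "C \<subseteq> A" and ch: "\<And>F G. F \<in> C \<Longrightarrow> G \<in> C \<Longrightarrow> F \<le> G \<or> G \<le> F"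
      by (auto simp: Chains_def relation_of_def)
    show "\<exists>u\<in>A. \<forall>a\<in>C. a \<ge> u"
    proof (cases "C = {}")
      case True
      have "sequentially \<in> A" by (simp add: A_def)
      with True show ?thesis by auto
    next
      case False
      have "\<not> eventually (\<lambda>_. False) (Inf C)"
      proof (subst eventually_Inf_base[OF False])
        fix F G assume "F \<in> C" "G \<in> C"
        then show "\<exists>x\<in>C. x \<le> inf F G" using ch[of F G] by (auto simp: inf_absorb1 inf_absorb2)
      next
        show "\<not> (\<exists>b\<in>C. \<forall>\<^sub>F _ in b. False)"
          using CA by (auto simp: A_def trivial_limit_def)
      qed
      then have "Inf C \<noteq> bot" by (auto simp: trivial_limit_def)
      moreover have "Inf C \<le> sequentially"
        using False CA by (auto simp: A_def intro: Inf_lower2)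
      ultimately have "Inf C \<in> A" by (simp add: A_def)
      then show ?thesis by (auto intro: Inf_lower)
    qed
  qed
  then obtain m where m: "m \<in> A" and min: "\<And>a. a \<in> A \<Longrightarrow> a \<le> m \<Longrightarrow> a = m" by auto
  have "eventually P m \<or> eventually (\<lambda>n. \<not> P n) m" for P
  proof (cases "inf m (principal {n. \<not> P n}) = bot")
    case True
    then have "eventually (\<lambda>_. False) (inf m (principal {n. \<not> P n}))" by simp
    then show ?thesis by (simp add: eventually_inf_principal)
  next
    case False
    then have "inf m (principal {n. \<not> P n}) \<in> A"
      using m by (auto simp: A_def intro: le_infI1)
    then have "inf m (principal {n. \<not> P n}) = m" by (intro min) auto
    moreover have "eventually (\<lambda>n. \<not> P n) (inf m (principal {n. \<not> P n}))"
      by (simp add: eventually_inf_principal)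
    ultimately show ?thesis by simp
  qed
  with m show ?thesis by (auto simp: free_ultrafilter_def A_def)
qed

lemma ultralimit_exists:
  fixes f :: "nat \<Rightarrow> 'a::heine_borel"
  assumes U: "free_ultrafilter U" and bdd: "bounded (range f)"
  shows "\<exists>l. (f \<longlongrightarrow> l) U"
proof -
  have "compact (closure (range f))" using bdd by simp
  moreover have "filtermap f U \<noteq> bot" using U by (simp add: free_ultrafilter_def filtermap_bot_iff)
  moreover have "eventually (\<lambda>x. x \<in> closure (range f)) (filtermap f U)"
    by (auto simp: eventually_filtermap closure_subset[THEN subsetD])
  ultimately obtain x where x: "inf (nhds x) (filtermap f U) \<noteq> bot"
    unfolding compact_filter by blast
  have "(f \<longlongrightarrow> x) U"
  proof (rule topological_tendstoI, rule ccontr)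
    fix S assume S: "open S" "x \<in> S" "\<not> eventually (\<lambda>n. f n \<in> S) U"
    then have "eventually (\<lambda>n. f n \<notin> S) U" using U by (auto simp: free_ultrafilter_def)
    then have "eventually (\<lambda>y. y \<notin> S) (filtermap f U)" by (simp add: eventually_filtermap)
    moreover have "eventually (\<lambda>y. y \<in> S) (nhds x)" using S eventually_nhds by blast
    ultimately have "eventually (\<lambda>_. False) (inf (nhds x) (filtermap f U))"
      unfolding eventually_inf by blast
    with x show False by (simp add: trivial_limit_def)
  qed
  then show ?thesis ..
qed

text \<open>
  Compactness of the dual ball in the weak* topology, in the only form in which it is used below: a
  norm bounded sequence of functionals has a pointwise limit along the ultrafilter.
\<close>

lemma ultralimit_functional:
  fixes \<phi> :: "nat \<Rightarrow> 'a::real_normed_vector \<Rightarrow> real"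
  assumes U: "free_ultrafilter U" and lin: "\<And>r. linear (\<phi> r)"
    and bd: "\<And>r x. \<bar>\<phi> r x\<bar> \<le> C * norm x"
  obtains \<psi> :: "'a \<Rightarrow>\<^sub>L real" where "\<And>x. ((\<lambda>r. \<phi> r x) \<longlongrightarrow> \<psi> x) U"
proof -
  have ne: "U \<noteq> bot" using U by (simp add: free_ultrafilter_def)
  have "\<exists>l. ((\<lambda>r. \<phi> r x) \<longlongrightarrow> l) U" for x
    by (rule ultralimit_exists[OF U]) (use bd[of _ x] in \<open>auto intro!: boundedI\<close>)
  then obtain p where p: "\<And>x. ((\<lambda>r. \<phi> r x) \<longlongrightarrow> p x) U" by metis
  have "p (x + y) = p x + p y" for x y
    using tendsto_unique[OF ne p[of "x + y"]] tendsto_add[OF p[of x] p[of y]]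
    by (simp add: linear_add[OF lin])
  moreover have "p (c *\<^sub>R x) = c *\<^sub>R p x" for x c
    using tendsto_unique[OF ne p[of "c *\<^sub>R x"]] tendsto_mult_left[OF p[of x], of c]
    by (simp add: linear_scale[OF lin])
  moreover have "norm (p x) \<le> norm x * C" for x
    using tendsto_upperbound[OF tendsto_rabs[OF p[of x]], of "C * norm x"] bd ne
    by (auto simp: mult.commute)
  ultimately have "bounded_linear p" by (intro bounded_linear_intro)
  with p show thesis by (intro that[of "Blinfun p"]) (simp add: bounded_linear_Blinfun_apply)
qed

section \<open>A Ramsey theorem for infinite sequences\<close>

text \<open>
  The sets \<open>W t\<close> are the successor sets of a tree of finite sequences, each of them large. Since only
  finitely many sequences have entries among the earlier members of \<open>l\<close>, and finitely many large sets
  meet in an infinite set, the next member can be chosen as a successor of all of them. Every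
  subsequence of \<open>l\<close> is then a branch.
\<close>

lemma subsequence_in_ultrafilter_tree:
  assumes U: "free_ultrafilter U" and W: "\<And>t. eventually (\<lambda>n. n \<in> W t) U"
  obtains l :: "nat \<Rightarrow> nat" where "strict_mono l"
    "\<And>r k. strict_mono r \<Longrightarrow> l (r k) \<in> W (map (\<lambda>i. l (r i)) [0..<k])"
proof -
  define Q where "Q F n \<longleftrightarrow> (\<forall>t. set t \<subseteq> F \<and> distinct t \<longrightarrow> n \<in> W t)" for F n
  have ex: "\<exists>\<^sub>\<infinity>n. Q F n" if F: "finite F" for F
  proof -
    have "eventually (\<lambda>n. \<forall>t\<in>{t. set t \<subseteq> F \<and> distinct t}. n \<in> W t) U"
      using finite_subset_distinct[OF F] W by (intro eventually_ball_finite) auto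
    then have ev: "eventually (Q F) U" unfolding Q_def by (rule eventually_mono) auto
    have "\<not> eventually (\<lambda>n. \<not> Q F n) sequentially"
    proof
      assume "eventually (\<lambda>n. \<not> Q F n) sequentially"
      then have "eventually (\<lambda>n. \<not> Q F n) U"
        using U by (auto simp: free_ultrafilter_def le_filter_def)
      with ev have "eventually (\<lambda>_. False) U" by eventually_elim simp
      with U show False by (simp add: free_ultrafilter_def trivial_limit_def)
    qed
    then show ?thesis by (simp only: frequently_def cofinite_eq_sequentially not_False_eq_True)
  qed
  obtain l :: "nat \<Rightarrow> nat" where l: "strict_mono l" "\<And>n. Q (l ` {..<n}) (l n)"
    using greedy_subsequence[of Q, OF ex] by blast
  show thesis
  proof (rule that[OF l(1)])
    fix r :: "nat \<Rightarrow> nat" and k assume r: "strict_mono r"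
    have "distinct (map (\<lambda>i. l (r i)) [0..<k])"
      using l(1) r by (auto simp: distinct_map strict_mono_eq inj_on_def)
    moreover have "set (map (\<lambda>i. l (r i)) [0..<k]) \<subseteq> l ` {..<r k}"
      using r by (auto simp: strict_mono_less)
    ultimately show "l (r k) \<in> W (map (\<lambda>i. l (r i)) [0..<k])"
      using l(2)[of "r k"] unfolding Q_def by blast
  qed
qed

text \<open>
  A least fixed point, so that its induction rule takes the place of an ordinal rank on the finite
  sequences.
\<close>

inductive escapes :: "nat filter \<Rightarrow> nat list set \<Rightarrow> nat list \<Rightarrow> bool" for U T where
  stop: "t \<notin> T \<Longrightarrow> escapes U T t"
| step: "eventually (\<lambda>n. n \<in> A) U \<Longrightarrow> (\<And>n. n \<in> A \<Longrightarrow> escapes U T (t @ [n])) \<Longrightarrow> escapes U T t"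

text \<open>
  The trees witnessing the escape of the extensions of \<open>t\<close> by one entry are grafted onto \<open>t\<close>.
\<close>

lemma escapes_imp_tree:
  assumes "escapes U T t"
  shows "\<exists>W. (\<forall>s. eventually (\<lambda>n. n \<in> W s) U) \<and>
    (\<forall>x. (\<forall>k. x k \<in> W (map x [0..<k])) \<longrightarrow> (\<exists>k. t @ map x [0..<k] \<notin> T))"
  using assms
proof induction
  case (stop t)
  have "\<exists>k. t @ map x [0..<k] \<notin> T" for x
    by (rule exI[of _ 0]) (use stop in simp)
  then show ?case by (intro exI[of _ "\<lambda>_. UNIV"] conjI allI impI) simp_all
next
  case (step A t)
  define R where "R n W \<longleftrightarrow> (\<forall>s. eventually (\<lambda>m. m \<in> W s) U) \<and>
    (\<forall>x. (\<forall>k. x k \<in> W (map x [0..<k])) \<longrightarrow> (\<exists>k. (t @ [n]) @ map x [0..<k] \<notin> T))"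
    for n and W :: "nat list \<Rightarrow> nat set"
  have "\<forall>n\<in>A. \<exists>W. R n W"
  proof
    fix n assume "n \<in> A"
    from step(3)[OF this] show "\<exists>W. R n W" unfolding R_def .
  qed
  from bchoice[OF this] obtain V where VR: "\<And>n. n \<in> A \<Longrightarrow> R n (V n)" by blast
  have V: "eventually (\<lambda>m. m \<in> V n s) U" if "n \<in> A" for n s
    using VR[OF that, unfolded R_def, THEN conjunct1] by simp
  have Vx: "\<exists>k. (t @ [n]) @ map x [0..<k] \<notin> T"
    if "n \<in> A" "\<And>k. x k \<in> V n (map x [0..<k])" for n x
    by (rule VR[OF that(1), unfolded R_def, THEN conjunct2, rule_format]) (rule that(2))
  define W where "W s = (case s of [] \<Rightarrow> A | n # s' \<Rightarrow> if n \<in> A then V n s' else UNIV)" for s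
  have leave: "\<exists>k. t @ map x [0..<k] \<notin> T" if x: "\<And>k. x k \<in> W (map x [0..<k])" for x
  proof -
    have x0: "x 0 \<in> A" using x[of 0] by (simp add: W_def)
    have shift: "map x [0..<Suc k] = x 0 # map (\<lambda>i. x (Suc i)) [0..<k]" for k
      by (simp add: map_upt_Suc del: upt_Suc)
    have "x (Suc k) \<in> V (x 0) (map (\<lambda>i. x (Suc i)) [0..<k])" for k
      using x[of "Suc k"] x0 unfolding shift by (simp add: W_def)
    from Vx[of "x 0" "\<lambda>i. x (Suc i)", OF x0 this]
    obtain k where "(t @ [x 0]) @ map (\<lambda>i. x (Suc i)) [0..<k] \<notin> T" by auto
    then have "t @ map x [0..<Suc k] \<notin> T" unfolding shift by simp
    then show ?thesis by (rule exI)
  qed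
  have "eventually (\<lambda>n. n \<in> W s) U" for s
    using step(1) V by (cases s) (simp_all add: W_def)
  then show ?case
    by (intro exI[of _ W] conjI allI impI) (simp, rule leave, simp)
qed

text \<open>
  Closed sets of infinite sequences are Ramsey. The sequences that do not escape have a large set of
  continuations that do not escape either, because an ultrafilter decides every set. Hence in both
  cases there is a tree with large successor sets, all of whose branches leave \<open>T\<close> or all of whose
  nodes are in \<open>T\<close>.
\<close>

theorem nash_williams:
  fixes T :: "nat list set"
  obtains l :: "nat \<Rightarrow> nat" where "strict_mono l"
    "(\<forall>r. strict_mono r \<longrightarrow> (\<forall>k. map (\<lambda>i. l (r i)) [0..<k] \<in> T)) \<or>
     (\<forall>r. strict_mono r \<longrightarrow> (\<exists>k. map (\<lambda>i. l (r i)) [0..<k] \<notin> T))"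
proof -
  obtain U where U: "free_ultrafilter U" using free_ultrafilter_exists by blast
  show thesis
  proof (cases "escapes U T []")
    case True
    from escapes_imp_tree[OF this, unfolded append_Nil]
    obtain W where W0: "\<forall>s. eventually (\<lambda>n. n \<in> W s) U"
      "\<forall>x. (\<forall>k. x k \<in> W (map x [0..<k])) \<longrightarrow> (\<exists>k. map x [0..<k] \<notin> T)"
      by (elim exE conjE)
    note W = W0[rule_format]
    obtain l :: "nat \<Rightarrow> nat" where l: "strict_mono l"
        "\<And>(r :: nat \<Rightarrow> nat) k. strict_mono r \<Longrightarrow> l (r k) \<in> W (map (\<lambda>i. l (r i)) [0..<k])"
      by (rule subsequence_in_ultrafilter_tree[of U W, OF U W(1)]) (rule that)
    have "\<exists>k. map (\<lambda>i. l (r i)) [0..<k] \<notin> T" if "strict_mono r" for r :: "nat \<Rightarrow> nat"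
      using W0(2) l(2)[OF that] by (elim allE[of _ "\<lambda>i. l (r i)"]) simp
    with l(1) show thesis by (intro that[of l]) simp_all
  next
    case False
    define W where "W t = {n. escapes U T t \<or> \<not> escapes U T (t @ [n])}" for t
    have "eventually (\<lambda>n. n \<in> W t) U" for t
    proof (cases "escapes U T t")
      case False
      then have "\<not> eventually (\<lambda>n. escapes U T (t @ [n])) U"
        using escapes.step[of "{n. escapes U T (t @ [n])}" U T t] unfolding mem_Collect_eq by blast
      then have "eventually (\<lambda>n. \<not> escapes U T (t @ [n])) U"
        using U by (auto simp: free_ultrafilter_def)
      then show ?thesis by (rule eventually_mono) (simp add: W_def)
    qed (simp add: W_def)
    then obtain l :: "nat \<Rightarrow> nat" where l: "strict_mono l"
        "\<And>(r :: nat \<Rightarrow> nat) k. strict_mono r \<Longrightarrow> l (r k) \<in> W (map (\<lambda>i. l (r i)) [0..<k])"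
      by (rule subsequence_in_ultrafilter_tree[of U W, OF U]) (rule that)
    have "\<not> escapes U T (map (\<lambda>i. l (r i)) [0..<k])" if "strict_mono r" for r k
    proof (induction k)
      case (Suc k)
      then show ?case using l(2)[OF that, of k] by (simp add: W_def)
    qed (use False in simp)
    then have "map (\<lambda>i. l (r i)) [0..<k] \<in> T" if "strict_mono r" for r k
      using that escapes.stop by blast
    with l(1) show thesis by (intro that[of l]) simp_all
  qed
qed

section \<open>Finitely additive means\<close>

locale mean =
  fixes m :: "'b set \<Rightarrow> real"
  assumes nonneg: "m A \<ge> 0"
    and additive: "A \<inter> B = {} \<Longrightarrow> m (A \<union> B) = m A + m B"
    and total: "m UNIV \<le> 1"
begin

lemma empty: "m {} = 0"
  using additive[of "{}" "{}"] by simp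

lemma union_inter: "m (A \<union> B) + m (A \<inter> B) = m A + m B"
proof -
  have "m (A \<union> B) = m A + m (B - A)" using additive[of A "B - A"] by simp
  moreover have "m B = m (B - A) + m (B \<inter> A)"
    by (subst additive[symmetric]) (auto intro: arg_cong[of _ _ m])
  ultimately show ?thesis by (simp add: Int_commute)
qed

lemma mono: "A \<subseteq> B \<Longrightarrow> m A \<le> m B"
  using additive[of A "B - A"] nonneg[of "B - A"] by (simp add: Un_absorb1)

lemma subadditive: "m (\<Union>i<(n::nat). B i) \<le> (\<Sum>i<n. m (B i))"
proof (induction n)
  case (Suc n)
  have "m (\<Union>i<Suc n. B i) \<le> m (\<Union>i<n. B i) + m (B n)"
    using union_inter[of "\<Union>i<n. B i" "B n"] nonneg[of "(\<Union>i<n. B i) \<inter> B n"]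
    by (simp add: lessThan_Suc Un_commute)
  with Suc show ?case by simp
qed (simp add: empty)

text \<open>
  The lower bound in the inclusion-exclusion formula. If the pairwise intersections are small, a few
  sets of mean bounded below already exhaust the total mean.
\<close>

lemma bonferroni: "(\<Sum>i<n. m (B i)) - (\<Sum>j<n. \<Sum>i<j. m (B i \<inter> B j)) \<le> m (\<Union>i<(n::nat). B i)"
proof (induction n)
  case (Suc n)
  have "m ((\<Union>i<n. B i) \<inter> B n) \<le> (\<Sum>i<n. m (B i \<inter> B n))"
    using subadditive[of "\<lambda>i. B i \<inter> B n" n] by simp
  then have "m (\<Union>i<n. B i) + m (B n) - (\<Sum>i<n. m (B i \<inter> B n)) \<le> m (\<Union>i<Suc n. B i)"
    using union_inter[of "\<Union>i<n. B i" "B n"] by (simp add: lessThan_Suc Un_commute)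
  with Suc show ?case by simp
qed (simp add: empty)

text \<open>
  Call \<open>E\<close> fat if infinitely many of the \<open>E \<inter> A k\<close> have mean above a positive bound. If \<open>E\<close> is fat,
  then so is \<open>E \<inter> A k\<close> for infinitely many \<open>k\<close>. Otherwise one could choose members of the sequence with
  \<open>E \<inter> A k\<close> not small and with arbitrarily small pairwise intersections, and sufficiently many of
  them would contradict the Bonferroni inequality. Starting with the full set, the finite
  intersections remain fat, hence nonempty.
\<close>

theorem subsequence_with_finite_intersections:
  assumes c: "c > 0" and A: "\<And>k. m (A k) \<ge> c"
  obtains r :: "nat \<Rightarrow> nat" where "strict_mono r" "\<And>k. \<exists>x. \<forall>i<k. x \<in> A (r i)"
proof -
  define fat where "fat E \<longleftrightarrow> (\<exists>d>0. \<exists>\<^sub>\<infinity>k. m (E \<inter> A k) \<ge> d)" for E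
  have fat_step: "\<exists>\<^sub>\<infinity>k. fat (E \<inter> A k)" if fatE: "fat E" for E
  proof (rule ccontr)
    assume "\<not> (\<exists>\<^sub>\<infinity>k. fat (E \<inter> A k))"
    then obtain N where N: "\<And>k. k \<ge> N \<Longrightarrow> \<not> fat (E \<inter> A k)"
      by (auto simp: INFM_nat_le)
    obtain d where d: "d > 0" "\<exists>\<^sub>\<infinity>k. m (E \<inter> A k) \<ge> d" using fatE by (auto simp: fat_def)
    obtain n :: nat where n: "real n > 2 / d" using reals_Archimedean2 by blast
    then have n0: "n > 0" using d(1) by (metis divide_pos_pos less_trans of_nat_0_less_iff zero_less_numeral)
    \<comment> \<open>\<open>n\<close> sets contribute at least \<open>n * d > 2\<close>, and their pairs at most \<open>n\<^sup>2 * b = n * d / 2\<close>.\<close>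
    define b where "b = d / (2 * real n)"
    have b: "b > 0" using d n0 by (simp add: b_def)
    define Q where "Q F k \<longleftrightarrow> k \<ge> N \<and> m (E \<inter> A k) \<ge> d \<and>
       (\<forall>i\<in>F. i \<ge> N \<longrightarrow> m (E \<inter> A i \<inter> A k) < b)" for F k
    have ex: "\<exists>\<^sub>\<infinity>k. Q F k" if F: "finite F" for F
    proof -
      have "\<forall>\<^sub>\<infinity>k. i \<ge> N \<longrightarrow> m (E \<inter> A i \<inter> A k) < b" for i
      proof (cases "i \<ge> N")
        case True
        then have "\<not> (\<exists>\<^sub>\<infinity>k. m (E \<inter> A i \<inter> A k) \<ge> b)" using N[OF True] b by (auto simp: fat_def)
        then show ?thesis by (simp add: not_frequently not_le)
      qed simp
      then have "\<forall>\<^sub>\<infinity>k. \<forall>i\<in>F. i \<ge> N \<longrightarrow> m (E \<inter> A i \<inter> A k) < b"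
        using F by (simp add: eventually_ball_finite)
      moreover have "\<forall>\<^sub>\<infinity>k. k \<ge> N" by (auto simp: MOST_nat_le)
      ultimately have "\<forall>\<^sub>\<infinity>k. k \<ge> N \<and> (\<forall>i\<in>F. i \<ge> N \<longrightarrow> m (E \<inter> A i \<inter> A k) < b)"
        by eventually_elim blast
      from frequently_eventually_conj[OF d(2) this] show ?thesis
        by (rule frequently_elim1) (auto simp: Q_def)
    qed
    obtain l :: "nat \<Rightarrow> nat" where l: "strict_mono l" "\<And>n. Q (l ` {..<n}) (l n)"
      using greedy_subsequence[of Q, OF ex] by blast
    define B where "B i = E \<inter> A (l i)" for i
    have Bd: "m (B i) \<ge> d" for i using l(2)[of i] by (simp add: Q_def B_def)
    have Bb: "m (B i \<inter> B j) \<le> b" if "i < j" for i j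
    proof -
      have "m (E \<inter> A (l i) \<inter> A (l j)) < b"
        using l(2)[of j] l(2)[of i] that by (auto simp: Q_def)
      moreover have "B i \<inter> B j = E \<inter> A (l i) \<inter> A (l j)" by (auto simp: B_def)
      ultimately show ?thesis by simp
    qed
    have "(\<Sum>j<n. \<Sum>i<j. m (B i \<inter> B j)) \<le> (\<Sum>j<n. \<Sum>i<j. b)"
      by (intro sum_mono Bb) simp
    also have "\<dots> = (\<Sum>j<n. real j * b)" by simp
    also have "\<dots> \<le> (\<Sum>j<n. real n * b)" using b by (intro sum_mono mult_right_mono) auto
    also have "\<dots> = real n * d / 2" using n0 by (simp add: b_def)
    finally have "(\<Sum>j<n. \<Sum>i<j. m (B i \<inter> B j)) \<le> real n * d / 2" .
    moreover have "real n * d \<le> (\<Sum>i<n. m (B i))"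
      using sum_mono[of "{..<n}" "\<lambda>_. d" "\<lambda>i. m (B i)"] Bd by simp
    moreover have "m (\<Union>i<n. B i) \<le> 1" using mono[of "\<Union>i<n. B i" UNIV] total by simp
    ultimately have "real n * d \<le> 2" using bonferroni[of B n] by linarith
    with n d(1) show False by (simp add: divide_simps)
  qed
  define Q where "Q F k \<longleftrightarrow> (fat (\<Inter>i\<in>F. A i) \<longrightarrow> fat (\<Inter>i\<in>insert k F. A i))" for F k
  have ex: "\<exists>\<^sub>\<infinity>k. Q F k" if "finite F" for F
  proof (cases "fat (\<Inter>i\<in>F. A i)")
    case True
    from fat_step[OF True] show ?thesis by (rule frequently_elim1) (simp add: Q_def Int_commute)
  next
    case False
    then show ?thesis by (simp add: Q_def)
  qed
  obtain r :: "nat \<Rightarrow> nat" where r: "strict_mono r" "\<And>n. Q (r ` {..<n}) (r n)"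
    using greedy_subsequence[of Q, OF ex] by blast
  have fat: "fat (\<Inter>i\<in>r ` {..<k}. A i)" for k
  proof (induction k)
    case 0
    have "\<exists>\<^sub>\<infinity>k. c \<le> m (UNIV \<inter> A k)" using A by simp
    with c show ?case unfolding fat_def by (intro exI[of _ c]) simp
  next
    case (Suc k)
    then show ?case using r(2)[of k] by (simp add: Q_def lessThan_Suc)
  qed
  have not_fat: "\<not> fat {}"
  proof
    assume "fat {}"
    then obtain d where "d > 0" "\<exists>\<^sub>\<infinity>k::nat. m {} \<ge> d" by (auto simp: fat_def)
    then show False using empty by simp
  qed
  have "\<exists>x. \<forall>i<k. x \<in> A (r i)" for k
  proof -
    have "(\<Inter>i\<in>r ` {..<k}. A i) \<noteq> {}"
      using fat[of k] not_fat by metis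
    then obtain x where "x \<in> (\<Inter>i\<in>r ` {..<k}. A i)" by blast
    then show ?thesis by (intro exI[of _ x]) simp
  qed
  with r(1) show thesis by (rule that)
qed

end

section \<open>The Hahn-Banach theorem\<close>

definition sublinear :: "('a::real_vector \<Rightarrow> real) \<Rightarrow> bool" where
  "sublinear q \<longleftrightarrow> (\<forall>x y. q (x + y) \<le> q x + q y) \<and> (\<forall>t x. 0 \<le> t \<longrightarrow> q (t *\<^sub>R x) = t * q x)"

lemma sublinear_add: "sublinear q \<Longrightarrow> q (x + y) \<le> q x + q y"
  and sublinear_scale: "sublinear q \<Longrightarrow> 0 \<le> t \<Longrightarrow> q (t *\<^sub>R x) = t * q x"
  by (auto simp: sublinear_def)

lemma sublinear_zero: "sublinear q \<Longrightarrow> q 0 = 0"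
  using sublinear_scale[of q 0 0] by simp

lemma sublinear_minus: "sublinear q \<Longrightarrow> - q (- x) \<le> q x"
  using sublinear_add[of q x "- x"] sublinear_zero[of q] by simp

text \<open>
  The infimal convolution of \<open>g\<close> and \<open>q\<close>. It serves twice. If \<open>g\<close> is linear on a subspace, every linear
  functional below the convolution extends \<open>g\<close>; and with a ray for \<open>S\<close> the convolution shows that a
  minimal sublinear functional is linear.
\<close>

lemma sublinear_below_on_cone:
  fixes q :: "'a::real_vector \<Rightarrow> real"
  assumes q: "sublinear q"
    and S: "0 \<in> S" "\<And>z w. z \<in> S \<Longrightarrow> w \<in> S \<Longrightarrow> z + w \<in> S"
      "\<And>t z. 0 < t \<Longrightarrow> z \<in> S \<Longrightarrow> t *\<^sub>R z \<in> S"
    and g: "g 0 = 0" "\<And>z w. z \<in> S \<Longrightarrow> w \<in> S \<Longrightarrow> g (z + w) = g z + g w"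
      "\<And>t z. 0 < t \<Longrightarrow> z \<in> S \<Longrightarrow> g (t *\<^sub>R z) = t * g z"
    and gq: "\<And>z. z \<in> S \<Longrightarrow> - g z \<le> q (- z)"
  obtains p where "sublinear p" "\<And>x. p x \<le> q x" "\<And>z. z \<in> S \<Longrightarrow> p z \<le> g z"
proof -
  define p where "p x = (INF z\<in>S. g z + q (x - z))" for x
  have low: "- q (- x) \<le> g z + q (x - z)" if "z \<in> S" for x z
    using gq[OF that] sublinear_add[OF q, of "x - z" "- x"] by simp
  have bdd: "bdd_below ((\<lambda>z. g z + q (x - z)) ` S)" for x
    using low by (intro bdd_belowI2)
  have p_le: "p x \<le> g z + q (x - z)" if "z \<in> S" for x z
    unfolding p_def by (rule cINF_lower[OF bdd that])
  have p_ge: "c \<le> p x" if "\<And>z. z \<in> S \<Longrightarrow> c \<le> g z + q (x - z)" for c x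
    unfolding p_def using S(1) that by (intro cINF_greatest) auto
  have add: "p (x + y) \<le> p x + p y" for x y
  proof -
    have 1: "p (x + y) - (g w + q (y - w)) \<le> p x" if w: "w \<in> S" for w
    proof (rule p_ge)
      fix z assume z: "z \<in> S"
      have "p (x + y) \<le> g (z + w) + q (x + y - (z + w))" by (rule p_le) (rule S(2)[OF z w])
      also have "q (x + y - (z + w)) \<le> q (x - z) + q (y - w)"
        using sublinear_add[OF q, of "x - z" "y - w"] by (simp add: algebra_simps)
      finally show "p (x + y) - (g w + q (y - w)) \<le> g z + q (x - z)" using g(2)[OF z w] by simp
    qed
    have "p (x + y) - p x \<le> p y" by (rule p_ge) (use 1 in \<open>simp add: algebra_simps\<close>)
    then show ?thesis by simp
  qed
  have scale_le: "p (t *\<^sub>R x) \<le> t * p x" if t: "0 < t" for t x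
  proof -
    have "p (t *\<^sub>R x) / t \<le> p x"
    proof (rule p_ge)
      fix z assume z: "z \<in> S"
      have "p (t *\<^sub>R x) \<le> g (t *\<^sub>R z) + q (t *\<^sub>R x - t *\<^sub>R z)" by (rule p_le) (rule S(3)[OF t z])
      also have "\<dots> = t * (g z + q (x - z))"
        using t sublinear_scale[OF q, of t "x - z"] g(3)[OF t z] by (simp add: algebra_simps)
      finally show "p (t *\<^sub>R x) / t \<le> g z + q (x - z)" using t by (simp add: field_simps)
    qed
    then show ?thesis using t by (simp add: field_simps)
  qed
  have p0: "p 0 = 0"
  proof (rule antisym)
    show "p 0 \<le> 0" using p_le[OF S(1), of 0] g(1) sublinear_zero[OF q] by simp
    show "0 \<le> p 0" by (rule p_ge) (use low[of _ 0] sublinear_zero[OF q] in simp)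
  qed
  have scale: "p (t *\<^sub>R x) = t * p x" if "0 \<le> t" for t x
  proof (cases "t = 0")
    case False
    then have t: "0 < t" using that by simp
    have "t * p x \<le> p (t *\<^sub>R x)"
      using scale_le[of "inverse t" "t *\<^sub>R x"] t by (simp add: field_simps)
    with scale_le[OF t] show ?thesis by (intro antisym)
  qed (simp add: p0)
  show thesis
  proof (rule that)
    show "sublinear p" using add scale by (simp add: sublinear_def)
    show "p x \<le> q x" for x using p_le[OF S(1), of x] g(1) by simp
    show "p z \<le> g z" if "z \<in> S" for z using p_le[OF that, of z] sublinear_zero[OF q] by simp
  qed
qed

text \<open>
  Zorn's lemma. The infimum over a chain is finite because all sublinear functionals below \<open>q\<close> are
  at least \<open>- q (- x)\<close> at \<open>x\<close>, and it is subadditive because any two members of a chain are comparable.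
\<close>

lemma minimal_sublinear_exists:
  fixes q :: "'a::real_vector \<Rightarrow> real"
  assumes q: "sublinear q"
  obtains f where "sublinear f" "\<And>x. f x \<le> q x"
    "\<And>p. sublinear p \<Longrightarrow> (\<And>x. p x \<le> f x) \<Longrightarrow> p = f"
proof -
  define A where "A = {p. sublinear p \<and> (\<forall>x. p x \<le> q x)}"
  have "\<exists>m\<in>A. \<forall>a\<in>A. (\<forall>x. a x \<le> m x) \<longrightarrow> a = m"
  proof (rule predicate_Zorn)
    show "partial_order_on A (relation_of (\<lambda>m a. \<forall>x. a x \<le> m x) A)"
      by (rule partial_order_on_relation_ofI) (auto intro: order.trans intro!: ext antisym)
  next
    fix C assume C: "C \<in> Chains (relation_of (\<lambda>m a. \<forall>x. a x \<le> m x) A)"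
    then have CA: "C \<subseteq> A"
      and ch: "\<And>a b. a \<in> C \<Longrightarrow> b \<in> C \<Longrightarrow> (\<forall>x. a x \<le> b x) \<or> (\<forall>x. b x \<le> a x)"
      by (auto simp: Chains_def relation_of_def)
    show "\<exists>u\<in>A. \<forall>a\<in>C. \<forall>x. u x \<le> a x"
    proof (cases "C = {}")
      case True
      then show ?thesis using q by (auto simp: A_def)
    next
      case False
      have C_sub: "sublinear a" and C_q: "a x \<le> q x" if "a \<in> C" for a x
        using that CA by (auto simp: A_def)
      define u where "u x = (INF a\<in>C. a x)" for x
      have low: "- q (- x) \<le> a x" if "a \<in> C" for a x
        using sublinear_minus[OF C_sub[OF that], of x] C_q[OF that, of "- x"] by simp
      have bdd: "bdd_below ((\<lambda>a. a x) ` C)" for x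
        using low by (intro bdd_belowI2)
      have u_le: "u x \<le> a x" if "a \<in> C" for a x
        unfolding u_def by (rule cINF_lower[OF bdd that])
      have u_ge: "c \<le> u x" if "\<And>a. a \<in> C \<Longrightarrow> c \<le> a x" for c x
        unfolding u_def using False that by (intro cINF_greatest) auto
      have add: "u (x + y) \<le> u x + u y" for x y
      proof -
        have 1: "u (x + y) - b y \<le> u x" if b: "b \<in> C" for b
        proof (rule u_ge)
          fix a assume a: "a \<in> C"
          \<comment> \<open>The smaller of the two comparable functionals bounds both summands.\<close>
          from ch[OF a b] show "u (x + y) - b y \<le> a x"
          proof
            assume "\<forall>x. a x \<le> b x"
            then have "a y \<le> b y" by blast
            then show ?thesis
              using u_le[OF a, of "x + y"] sublinear_add[OF C_sub[OF a], of x y] by linarith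
          next
            assume "\<forall>x. b x \<le> a x"
            then have "b x \<le> a x" by blast
            then show ?thesis
              using u_le[OF b, of "x + y"] sublinear_add[OF C_sub[OF b], of x y] by linarith
          qed
        qed
        have "u (x + y) - u x \<le> u y" by (rule u_ge) (use 1 in \<open>simp add: algebra_simps\<close>)
        then show ?thesis by simp
      qed
      have scale: "u (t *\<^sub>R x) = t * u x" if t: "0 \<le> t" for t x
      proof (cases "t = 0")
        case True
        have "u 0 = (INF a\<in>C. 0)" unfolding u_def
          by (rule INF_cong) (auto simp: sublinear_zero C_sub)
        then show ?thesis using True False by simp
      next
        case False
        then have t: "0 < t" using that by simp
        have "u (t *\<^sub>R x) / t \<le> u x"
          using u_le[of _ "t *\<^sub>R x"] sublinear_scale[OF C_sub, of _ t x] t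
          by (intro u_ge) (simp add: field_simps)
        moreover have "t * u x \<le> u (t *\<^sub>R x)"
        proof (rule u_ge)
          fix a assume a: "a \<in> C"
          show "t * u x \<le> a (t *\<^sub>R x)"
            using u_le[OF a, of x] sublinear_scale[OF C_sub[OF a], of t x] t by simp
        qed
        ultimately show ?thesis using t by (simp add: field_simps)
      qed
      obtain a where "a \<in> C" using False by blast
      then have "u x \<le> q x" for x using u_le[of a x] C_q[of a x] by simp
      with add scale have "u \<in> A" by (simp add: A_def sublinear_def)
      with u_le show ?thesis by blast
    qed
  qed
  then obtain m where m: "m \<in> A" and min: "\<And>a. a \<in> A \<Longrightarrow> (\<forall>x. a x \<le> m x) \<Longrightarrow> a = m" by blast
  show thesis
  proof (rule that[of m])
    fix p assume p: "sublinear p" "\<And>x. p x \<le> m x"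
    then have "p x \<le> q x" for x using m p(2)[of x] by (auto simp: A_def intro: order.trans)
    with p show "p = m" by (intro min) (auto simp: A_def)
  qed (use m in \<open>auto simp: A_def\<close>)
qed

text \<open>
  Infimal convolution along the ray through \<open>- y\<close> yields a sublinear functional below \<open>f\<close> whose value
  at \<open>- y\<close> is at most \<open>- f y\<close>. By minimality this functional is \<open>f\<close>.
\<close>

lemma minimal_sublinear_linear:
  fixes f :: "'a::real_vector \<Rightarrow> real"
  assumes f: "sublinear f" and min: "\<And>p. sublinear p \<Longrightarrow> (\<And>x. p x \<le> f x) \<Longrightarrow> p = f"
  shows "linear f"
proof -
  have neg: "f (- y) = - f y" for y
  proof -
    define S where "S = (\<lambda>t. - (t *\<^sub>R y)) ` {0..}"
    define g where "g z = (if z = 0 then 0 else - f (- z))" for z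
    have g: "g (- (t *\<^sub>R y)) = - (t * f y)" if "0 \<le> t" for t
      using that sublinear_zero[OF f] by (auto simp: g_def sublinear_scale[OF f] simp flip: scaleR_minus_right)
    obtain p where p: "sublinear p" "\<And>x. p x \<le> f x" "\<And>z. z \<in> S \<Longrightarrow> p z \<le> g z"
    proof (rule sublinear_below_on_cone[OF f, of S g])
      show "0 \<in> S" by (auto simp: S_def intro!: image_eqI[of _ _ 0])
      show "z + w \<in> S" if "z \<in> S" "w \<in> S" for z w
        using that by (auto simp: S_def image_iff algebra_simps intro: bexI[of _ "_ + _"])
      show "t *\<^sub>R z \<in> S" if "0 < t" "z \<in> S" for t z
        using that by (auto simp: S_def image_iff)
      show "g 0 = 0" by (simp add: g_def)
      show "g (z + w) = g z + g w" if zw: "z \<in> S" "w \<in> S" for z w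
      proof -
        obtain s t where st: "0 \<le> s" "0 \<le> t" "z = - (s *\<^sub>R y)" "w = - (t *\<^sub>R y)"
          using zw by (auto simp: S_def)
        have "z + w = - ((s + t) *\<^sub>R y)" using st by (simp add: algebra_simps)
        then show ?thesis using st g[of "s + t"] g[of s] g[of t] by (simp add: algebra_simps)
      qed
      show "g (t *\<^sub>R z) = t * g z" if t: "0 < t" and z: "z \<in> S" for t z
      proof -
        obtain s where s: "0 \<le> s" "z = - (s *\<^sub>R y)" using z by (auto simp: S_def)
        then have "t *\<^sub>R z = - ((t * s) *\<^sub>R y)" by simp
        then show ?thesis using s t g[of "t * s"] g[of s] by simp
      qed
      show "- g z \<le> f (- z)" for z using sublinear_zero[OF f] by (simp add: g_def)
    qed auto
    have "p = f" using p by (intro min)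
    moreover have "- y \<in> S" by (auto simp: S_def intro!: image_eqI[of _ _ 1])
    ultimately have "f (- y) \<le> - f y" using p(3)[of "- y"] g[of 1] by simp
    with sublinear_minus[OF f, of y] show ?thesis by simp
  qed
  show ?thesis
  proof (rule linearI)
    show "f (x + y) = f x + f y" for x y
      using sublinear_add[OF f, of x y] sublinear_add[OF f, of "- x" "- y"] neg[of x] neg[of y]
        neg[of "x + y"] by simp
    show "f (c *\<^sub>R x) = c *\<^sub>R f x" for c x
      using sublinear_scale[OF f, of c x] sublinear_scale[OF f, of "- c" x] neg[of "c *\<^sub>R x"]
      by (cases "0 \<le> c") simp_all
  qed
qed

theorem hahn_banach_cone:
  fixes q :: "'a::real_vector \<Rightarrow> real"
  assumes q: "sublinear q"
    and S: "0 \<in> S" "\<And>z w. z \<in> S \<Longrightarrow> w \<in> S \<Longrightarrow> z + w \<in> S"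
      "\<And>t z. 0 < t \<Longrightarrow> z \<in> S \<Longrightarrow> t *\<^sub>R z \<in> S"
    and g: "g 0 = 0" "\<And>z w. z \<in> S \<Longrightarrow> w \<in> S \<Longrightarrow> g (z + w) = g z + g w"
      "\<And>t z. 0 < t \<Longrightarrow> z \<in> S \<Longrightarrow> g (t *\<^sub>R z) = t * g z"
    and gq: "\<And>z. z \<in> S \<Longrightarrow> - g z \<le> q (- z)"
  obtains f where "linear f" "\<And>x. f x \<le> q x" "\<And>z. z \<in> S \<Longrightarrow> f z \<le> g z"
proof -
  obtain p where p: "sublinear p" "\<And>x. p x \<le> q x" "\<And>z. z \<in> S \<Longrightarrow> p z \<le> g z"
    using sublinear_below_on_cone[OF q, of S g] S g gq by blast
  obtain f where f: "sublinear f" "\<And>x. f x \<le> p x"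
    "\<And>h. sublinear h \<Longrightarrow> (\<And>x. h x \<le> f x) \<Longrightarrow> h = f"
    using minimal_sublinear_exists[OF p(1)] by blast
  show thesis
  proof (rule that)
    show "linear f" using f(1) by (rule minimal_sublinear_linear) (rule f(3))
    show "f x \<le> q x" for x using f(2)[of x] p(2)[of x] by simp
    show "f z \<le> g z" if "z \<in> S" for z using f(2)[of z] p(3)[OF that] by simp
  qed
qed

theorem hahn_banach_norm:
  fixes Y :: "'a::real_normed_vector set"
  assumes Y: "subspace Y" and g: "\<And>y z. y \<in> Y \<Longrightarrow> z \<in> Y \<Longrightarrow> g (y + z) = g y + g z"
    "\<And>c y. y \<in> Y \<Longrightarrow> g (c *\<^sub>R y) = c * g y"
    and le: "\<And>y. y \<in> Y \<Longrightarrow> g y \<le> C * norm y" and C: "0 \<le> C"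
  obtains f :: "'a \<Rightarrow>\<^sub>L real" where "\<And>y. y \<in> Y \<Longrightarrow> f y = g y" "norm f \<le> C"
proof -
  have q: "sublinear (\<lambda>x. C * norm x)"
    using C by (auto simp: sublinear_def norm_triangle_ineq mult_left_mono simp flip: distrib_left)
  have g_minus: "g (- z) = - g z" if "z \<in> Y" for z
    using g(2)[OF that, of "-1"] by simp
  obtain f where f: "linear f" "\<And>x. f x \<le> C * norm x" "\<And>z. z \<in> Y \<Longrightarrow> f z \<le> g z"
  proof (rule hahn_banach_cone[OF q, of Y g])
    show "g 0 = 0" using g(2)[OF subspace_0[OF Y], of 0] by simp
    show "- g z \<le> C * norm (- z)" if "z \<in> Y" for z
      using le[OF subspace_neg[OF Y that]] g_minus[OF that] by simp
  qed (use Y g in \<open>auto simp: subspace_0 subspace_add subspace_scale\<close>)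
  have f_abs: "\<bar>f x\<bar> \<le> C * norm x" for x
    using f(2)[of x] f(2)[of "- x"] linear_neg[OF f(1), of x] by (simp add: abs_le_iff)
  have "bounded_linear f"
    using f(1) f_abs by (intro bounded_linear_intro[of _ C])
      (auto simp: linear_add linear_scale mult.commute)
  then have app: "blinfun_apply (Blinfun f) x = f x" for x
    by (simp add: bounded_linear_Blinfun_apply)
  show thesis
  proof (rule that[of "Blinfun f"])
    show "Blinfun f y = g y" if y: "y \<in> Y" for y
      using f(3)[OF y] f(3)[OF subspace_neg[OF Y y]] linear_neg[OF f(1), of y] g_minus[OF y]
      by (simp add: app)
    show "norm (Blinfun f) \<le> C"
      using f_abs C by (intro norm_blinfun_bound) (simp_all add: app)
  qed
qed

lemma norming_functional:
  fixes x :: "'a::real_normed_vector"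
  obtains f :: "'a \<Rightarrow>\<^sub>L real" where "f x = norm x" "norm f \<le> 1"
proof (cases "x = 0")
  case True
  then show thesis by (intro that[of 0]) simp_all
next
  case False
  define g where "g y = (THE t. y = t *\<^sub>R x) * norm x" for y
  have g: "g (t *\<^sub>R x) = t * norm x" for t
    using False by (simp add: g_def)
  obtain f :: "'a \<Rightarrow>\<^sub>L real" where f: "\<And>y. y \<in> range (\<lambda>t. t *\<^sub>R x) \<Longrightarrow> f y = g y" "norm f \<le> 1"
  proof (rule hahn_banach_norm[of "range (\<lambda>t. t *\<^sub>R x)" g 1])
    show "subspace (range (\<lambda>t. t *\<^sub>R x))"
      using subspace_span[of "{x}"] by (simp add: span_singleton)
    show "g (y + z) = g y + g z" if "y \<in> range (\<lambda>t. t *\<^sub>R x)" "z \<in> range (\<lambda>t. t *\<^sub>R x)" for y z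
      using that g by (auto simp: distrib_right simp flip: scaleR_add_left)
    show "g (c *\<^sub>R y) = c * g y" if "y \<in> range (\<lambda>t. t *\<^sub>R x)" for c y
      using that g by auto
    show "g y \<le> 1 * norm y" if "y \<in> range (\<lambda>t. t *\<^sub>R x)" for y
      using that g by (auto intro!: mult_right_mono)
  qed auto
  have "f x = norm x" using f(1)[of x] g[of 1] by (metis rangeI scaleR_one mult_1)
  with f(2) show thesis by (intro that[of f])
qed

text \<open>
  This is Mazur's theorem for subspaces: what is closed in norm is weakly closed.
\<close>

lemma functional_separating_from_subspace:
  fixes x :: "'a::real_normed_vector"
  assumes Z: "subspace Z" and d: "0 < d" "\<And>z. z \<in> Z \<Longrightarrow> d \<le> norm (x - z)"
  obtains f :: "'a \<Rightarrow>\<^sub>L real" where "\<And>z. z \<in> Z \<Longrightarrow> f z = 0" "f x \<noteq> 0"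
proof -
  let ?Y = "{z + t *\<^sub>R x | z t. z \<in> Z}"
  have xZ: "x \<notin> Z" using d(2)[of x] d(1) by auto
  have unique: "s = t" if "z + s *\<^sub>R x = w + t *\<^sub>R x" "z \<in> Z" "w \<in> Z" for z w s t
  proof (rule ccontr)
    assume "s \<noteq> t"
    have "(t - s) *\<^sub>R x = z - w" using that(1) by (simp add: algebra_simps)
    then have "x = inverse (t - s) *\<^sub>R (z - w)" using \<open>s \<noteq> t\<close>
      by (metis eq_iff_diff_eq_0 scaleR_scaleR left_inverse scaleR_one)
    with that Z xZ show False by (metis subspace_diff subspace_scale)
  qed
  define g where "g y = (THE t. \<exists>z\<in>Z. y = z + t *\<^sub>R x)" for y
  have g: "g (z + t *\<^sub>R x) = t" if "z \<in> Z" for z t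
    unfolding g_def by (rule the_equality) (use that unique in blast)+
  have le: "\<bar>t\<bar> * d \<le> norm (z + t *\<^sub>R x)" if z: "z \<in> Z" for z t
  proof (cases "t = 0")
    case False
    have "- (inverse t) *\<^sub>R z \<in> Z" using Z z by (intro subspace_scale)
    from d(2)[OF this] have "\<bar>t\<bar> * d \<le> \<bar>t\<bar> * norm (x + inverse t *\<^sub>R z)"
      by (intro mult_left_mono) simp_all
    also have "\<dots> = norm (t *\<^sub>R (x + inverse t *\<^sub>R z))" by simp
    also have "t *\<^sub>R (x + inverse t *\<^sub>R z) = z + t *\<^sub>R x" using False by (simp add: algebra_simps)
    finally show ?thesis .
  qed simp
  obtain f :: "'a \<Rightarrow>\<^sub>L real" where f: "\<And>y. y \<in> ?Y \<Longrightarrow> f y = g y" "norm f \<le> inverse d"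
  proof (rule hahn_banach_norm[of ?Y g "inverse d"])
    have add: "(z + s *\<^sub>R x) + (w + t *\<^sub>R x) = (z + w) + (s + t) *\<^sub>R x" for z w s t
      by (simp add: algebra_simps)
    have scale: "c *\<^sub>R (z + s *\<^sub>R x) = c *\<^sub>R z + (c * s) *\<^sub>R x" for z c s
      by (simp add: algebra_simps)
    show "subspace ?Y"
    proof (rule subspaceI)
      show "0 \<in> ?Y" using subspace_0[OF Z] by (intro CollectI exI[of _ 0]) simp
      show "y + v \<in> ?Y" if "y \<in> ?Y" "v \<in> ?Y" for y v
        using that add subspace_add[OF Z] by blast
      show "c *\<^sub>R y \<in> ?Y" if "y \<in> ?Y" for c y
        using that scale subspace_scale[OF Z] by blast
    qed
    show "g (y + v) = g y + g v" if "y \<in> ?Y" "v \<in> ?Y" for y v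
      using that by (auto simp: g add subspace_add[OF Z])
    show "g (c *\<^sub>R y) = c * g y" if "y \<in> ?Y" for c y
      using that by (auto simp only: scale g subspace_scale[OF Z])
    show "g y \<le> inverse d * norm y" if y: "y \<in> ?Y" for y
    proof -
      obtain z t where z: "z \<in> Z" "y = z + t *\<^sub>R x" using y by blast
      have "t * d \<le> \<bar>t\<bar> * d" using d(1) by (intro mult_right_mono) auto
      then have "t * d \<le> norm y" unfolding z(2) using le[OF z(1), of t] by linarith
      then show ?thesis using d(1) z by (simp add: g field_simps)
    qed
  qed (use d(1) in auto)
  show thesis
  proof (rule that)
    show "f z = 0" if "z \<in> Z" for z
      using f(1)[of z] g[OF that, of 0] that by force
    have "f x = g x" using subspace_0[OF Z] by (intro f(1) CollectI exI[of _ 0] exI[of _ 1]) simp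
    then show "f x \<noteq> 0" using g[OF subspace_0[OF Z], of 1] by simp
  qed
qed

section \<open>Uniform boundedness\<close>

text \<open>
  A gliding hump, without Baire category. If \<open>v n\<close> is a subsequence of norm above \<open>4 ^ n\<close>, the
  functional \<open>\<Sum>n. \<plusminus> (1/3) ^ n * h n\<close>, where \<open>h n\<close> norms \<open>v n\<close>, has a value of order \<open>(4/3) ^ n\<close> at \<open>v n\<close>.
  The sign of each term is chosen so that it does not cancel against the preceding ones, and the
  geometric series of the following ones is at most half of it.
\<close>

theorem weakly_bounded_imp_norm_bounded:
  fixes y :: "nat \<Rightarrow> 'a::real_normed_vector"
  assumes wb: "\<And>f :: 'a \<Rightarrow>\<^sub>L real. bounded (range (\<lambda>k. f (y k)))"
  shows "bounded (range y)"
proof (rule ccontr)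
  assume "\<not> bounded (range y)"
  then have "\<exists>k. norm (y k) > c" for c
    unfolding bounded_iff by (metis UNIV_I image_iff not_le)
  then have "\<forall>n. \<exists>k. norm (y k) > 4 ^ n" by blast
  then obtain k where k: "\<And>n. norm (y (k n)) > 4 ^ n" by metis
  define v where "v n = y (k n)" for n
  have "\<forall>n. \<exists>f :: 'a \<Rightarrow>\<^sub>L real. blinfun_apply f (v n) = norm (v n) \<and> norm f \<le> 1"
    using norming_functional by blast
  then obtain h :: "nat \<Rightarrow> 'a \<Rightarrow>\<^sub>L real" where h: "\<And>n. h n (v n) = norm (v n)" "\<And>n. norm (h n) \<le> 1"
    by metis
  have step: "\<exists>g. (g = f + (1/3) ^ n *\<^sub>R h n \<or> g = f - (1/3) ^ n *\<^sub>R h n) \<and>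
      \<bar>g (v n)\<bar> \<ge> (1/3) ^ n * norm (v n)" for f and n
  proof -
    have "\<bar>f (v n) + (1/3) ^ n * norm (v n)\<bar> \<ge> (1/3) ^ n * norm (v n) \<or>
      \<bar>f (v n) - (1/3) ^ n * norm (v n)\<bar> \<ge> (1/3) ^ n * norm (v n)" by linarith
    then show ?thesis
      by (elim disjE) (auto simp: blinfun.add_left blinfun.diff_left blinfun.scaleR_left h)
  qed
  obtain nx where nx: "\<And>f n. (nx f n = f + (1/3) ^ n *\<^sub>R h n \<or> nx f n = f - (1/3) ^ n *\<^sub>R h n) \<and>
      \<bar>nx f n (v n)\<bar> \<ge> (1/3) ^ n * norm (v n)"
    using step by metis
  define F where "F = rec_nat (0 :: 'a \<Rightarrow>\<^sub>L real) (\<lambda>n f. nx f n)"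
  have F: "F (Suc n) = nx (F n) n" for n by (simp add: F_def)
  define s where "s n = F (Suc n) - F n" for n
  have s: "norm (s n) \<le> (1/3) ^ n" for n
  proof -
    have "norm (s n) = (1/3) ^ n * norm (h n)"
      using nx[of "F n" n] by (auto simp: s_def F)
    then show ?thesis using mult_left_mono[OF h(2)[of n], of "(1/3) ^ n"] by simp
  qed
  have summ: "summable s"
    by (rule summable_comparison_test'[OF summable_geometric[of "1/3 :: real"] s]) simp
  define f where "f = suminf s"
  have tail: "norm (f - F (Suc n)) \<le> (1/3) ^ n / 2" for n
  proof -
    have "f = (\<Sum>i. s (i + Suc n)) + (\<Sum>i<Suc n. s i)"
      unfolding f_def by (rule suminf_split_initial_segment[OF summ])
    also have "(\<Sum>i<Suc n. s i) = F (Suc n)"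
      unfolding s_def by (subst sum_lessThan_telescope) (simp add: F_def)
    finally have "f - F (Suc n) = (\<Sum>i. s (i + Suc n))" by simp
    moreover have "norm (\<Sum>i. s (i + Suc n)) \<le> (\<Sum>i. (1/3) ^ Suc n * (1/3 :: real) ^ i)"
    proof (rule norm_suminf_le)
      show "norm (s (i + Suc n)) \<le> (1/3) ^ Suc n * (1/3) ^ i" for i
        using s[of "i + Suc n"] by (simp add: power_add mult_ac)
      show "summable (\<lambda>i. (1/3) ^ Suc n * (1/3 :: real) ^ i)"
        by (intro summable_mult summable_geometric) simp
    qed
    moreover have "(\<Sum>i. (1/3) ^ Suc n * (1/3 :: real) ^ i) = (1/3) ^ n / 2"
      by (subst suminf_mult) (auto simp: suminf_geometric summable_geometric)
    ultimately show ?thesis by simp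
  qed
  obtain B where B: "\<And>j. \<bar>f (y j)\<bar> \<le> B" using wb[of f] by (auto simp: bounded_iff)
  have "(4/3) ^ n / 2 \<le> B" for n
  proof -
    have "\<bar>f (v n) - F (Suc n) (v n)\<bar> \<le> (1/3) ^ n / 2 * norm (v n)"
      using order.trans[OF norm_blinfun[of "f - F (Suc n)" "v n"] mult_right_mono[OF tail]]
      by (simp add: blinfun.diff_left)
    moreover have "\<bar>F (Suc n) (v n)\<bar> \<ge> (1/3) ^ n * norm (v n)" using nx F by simp
    ultimately have "\<bar>f (v n)\<bar> \<ge> (1/3) ^ n / 2 * norm (v n)" by linarith
    moreover have "(1/3) ^ n / 2 * norm (v n) \<ge> (1/3) ^ n / 2 * 4 ^ n"
      using k[of n] by (intro mult_left_mono) (auto simp: v_def)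
    moreover have "(1/3) ^ n / 2 * 4 ^ n = (4/3 :: real) ^ n / 2" by (simp add: power_divide)
    ultimately have "(4/3) ^ n / 2 \<le> \<bar>f (v n)\<bar>" by linarith
    then show ?thesis using B[of "k n"] unfolding v_def by linarith
  qed
  moreover obtain n where "(4/3 :: real) ^ n > 2 * B" using real_arch_pow[of "4/3" "2 * B"] by auto
  ultimately show False by (metis divide_le_eq_numeral1(1) mult.commute not_le)
qed

section \<open>Real and complex scalars\<close>

text \<open>
  Multiplication by a unit is isometric because the norm is multiplicative, and the norm determines
  the inner product by polarization.
\<close>

lemma inner_mult_unit:
  fixes u :: "'k::{real_normed_field,euclidean_space}"
  assumes "norm u = 1"
  shows "inner (u * x) (u * y) = inner x y"
proof -
  have polar: "inner a b = ((norm (a + b))\<^sup>2 - (norm a)\<^sup>2 - (norm b)\<^sup>2) / 2" for a b :: 'k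
    by (simp add: power2_norm_eq_inner inner_add_left inner_add_right inner_commute)
  have "norm (u * x + u * y) = norm (x + y)"
    by (simp add: norm_mult assms flip: distrib_left)
  then show ?thesis unfolding polar by (simp add: norm_mult assms)
qed

text \<open>
  The identity for real numbers and complex conjugation for complex ones.
\<close>

definition conjugate :: "'k::{real_normed_field,euclidean_space} \<Rightarrow> 'k" where
  "conjugate c = (norm c)\<^sup>2 *\<^sub>R inverse c"

lemma norm_conjugate [simp]: "norm (conjugate c) = norm c"
  by (cases "c = 0") (simp_all add: conjugate_def norm_inverse power2_eq_square)

lemma inner_conjugate: "inner (c * x) y = inner x (conjugate c * y)"
proof (cases "c = 0")
  case False
  define u where "u = inverse (norm c) *\<^sub>R c"
  have u: "norm u = 1" "u \<noteq> 0" "c = norm c *\<^sub>R u" using False by (simp_all add: u_def)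
  have y: "u * (inverse u * y) = y" using u(2) by (simp add: mult.assoc[symmetric])
  have "inner (c * x) y = norm c * inner (u * x) (u * (inverse u * y))"
    unfolding y by (subst u(3)) simp
  also have "\<dots> = norm c * inner x (inverse u * y)" by (simp add: inner_mult_unit[OF u(1)])
  also have "norm c *\<^sub>R inverse u = conjugate c"
    using False by (simp add: u_def conjugate_def power2_eq_square inverse_scaleR_distrib)
  then have "norm c * inner x (inverse u * y) = inner x (conjugate c * y)"
    by (metis inner_scaleR_right mult_scaleR_left)
  finally show ?thesis .
qed (simp add: conjugate_def)

lemma inner_eq_inner_one: "inner x y = inner 1 (conjugate x * y)"
  using inner_conjugate[of x 1 y] by simp

lemma inner_one_zero_imp_zero:
  fixes z :: "'k::{real_normed_field,euclidean_space}"
  assumes "\<And>v. inner 1 (z * v) = 0"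
  shows "z = 0"
proof (rule ccontr)
  assume "z \<noteq> 0"
  then show False using assms[of "inverse z"] by (simp add: dot_square_norm)
qed

lemma conjugate_add: "conjugate (x + y) = conjugate x + conjugate y"
proof -
  have "inner 1 ((conjugate (x + y) - (conjugate x + conjugate y)) * v) = 0" for v
    by (simp add: left_diff_distrib distrib_right inner_diff_right inner_add_right
        inner_eq_inner_one[symmetric] inner_add_left)
  from inner_one_zero_imp_zero[OF this] show ?thesis by simp
qed

lemma conjugate_scaleR: "conjugate (r *\<^sub>R x) = r *\<^sub>R conjugate x"
proof (cases "r = 0")
  case False
  have "(norm (r *\<^sub>R x))\<^sup>2 = r * (r * (norm x)\<^sup>2)"
    by (simp add: power_mult_distrib power2_eq_square[of r])
  then show ?thesis using False by (simp add: conjugate_def inverse_scaleR_distrib)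
qed (simp add: conjugate_def)

lemma conjugate_mult: "conjugate (x * y) = conjugate x * conjugate y"
  by (simp add: conjugate_def norm_mult power_mult_distrib mult_ac)

lemma conjugate_conjugate [simp]: "conjugate (conjugate x) = x"
proof (cases "x = 0")
  case False
  have "conjugate (conjugate x) = ((norm x)\<^sup>2 * inverse ((norm x)\<^sup>2)) *\<^sub>R x"
    by (subst (2) conjugate_def) (simp add: conjugate_scaleR, simp add: conjugate_def norm_inverse power_inverse)
  then show ?thesis using False by simp
qed (simp add: conjugate_def)

text \<open>
  Up to a rotation common to all terms, real parts control absolute values: for complex scalars, one
  of the sums of the absolute real parts and of the absolute imaginary parts is at least half of the
  sum of the absolute values.
\<close>

lemma sum_norm_le_inner_one:
  fixes c :: "'i \<Rightarrow> 'k::{real_normed_field,euclidean_space}"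
  obtains b :: 'k where "norm b = 1" "(\<Sum>i\<in>I. norm (c i)) \<le> DIM('k) * (\<Sum>i\<in>I. \<bar>inner 1 (b * c i)\<bar>)"
proof -
  have "(\<Sum>i\<in>I. norm (c i)) \<le> (\<Sum>i\<in>I. \<Sum>b\<in>Basis. \<bar>inner (c i) b\<bar>)"
    by (intro sum_mono norm_le_l1)
  also have "\<dots> = (\<Sum>b\<in>Basis. \<Sum>i\<in>I. \<bar>inner (c i) b\<bar>)" by (rule sum.swap)
  finally have le: "(\<Sum>i\<in>I. norm (c i)) \<le> (\<Sum>b\<in>Basis. \<Sum>i\<in>I. \<bar>inner (c i) b\<bar>)" .
  have "\<exists>b\<in>Basis. (\<Sum>i\<in>I. norm (c i)) \<le> DIM('k) * (\<Sum>i\<in>I. \<bar>inner (c i) b\<bar>)"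
  proof (rule ccontr)
    assume "\<not> ?thesis"
    then have "(\<Sum>b\<in>(Basis :: 'k set). \<Sum>i\<in>I. \<bar>inner (c i) b\<bar>)
        < (\<Sum>b\<in>(Basis :: 'k set). (\<Sum>i\<in>I. norm (c i)) / DIM('k))"
      by (intro sum_strict_mono) (auto simp: field_simps not_le)
    also have "\<dots> = (\<Sum>i\<in>I. norm (c i))" by simp
    finally show False using le by simp
  qed
  then obtain b where b: "b \<in> Basis" "(\<Sum>i\<in>I. norm (c i)) \<le> DIM('k) * (\<Sum>i\<in>I. \<bar>inner (c i) b\<bar>)"
    by blast
  moreover have "inner (c i) b = inner 1 (conjugate b * c i)" for i
    by (simp add: inner_eq_inner_one[symmetric] inner_commute)
  ultimately show thesis by (intro that[of "conjugate b"]) simp_all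
qed

context normed_space_over
begin

lemma bounded_bilinear_scl: "bounded_bilinear scl"
proof
  show "scl (a + a') b = scl a b + scl a' b" for a a' b by (rule scale_left_distrib)
  show "scl a (b + b') = scl a b + scl a b'" for a b b' by (rule scale_right_distrib)
  show "scl (r *\<^sub>R a) b = r *\<^sub>R scl a b" for r a b
    by (simp add: scaleR_conv_of_real scl_of_real flip: scale_scale)
  show "scl a (r *\<^sub>R b) = r *\<^sub>R scl a b" for r a b
    by (simp add: scl_of_real[symmetric] mult.commute)
  show "\<exists>K. \<forall>a b. norm (scl a b) \<le> norm a * norm b * K"
    by (rule exI[of _ 1]) (simp add: norm_scl)
qed

end

text \<open>
  Every real functional is the real part of a functional over the field, as in the theorem of
  Bohnenblust and Sobczyk. The inner products of \<open>F x\<close> with the basis are forced; linearity of the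
  conjugation extends the formula to all scalars \<open>c\<close>, and taking \<open>c = F x\<close> gives the bound on the norm.
\<close>

lemma dual_from_real_functional:
  fixes scl :: "'k::{real_normed_field,euclidean_space} \<Rightarrow> 'a::real_normed_vector \<Rightarrow> 'a"
    and g :: "'a \<Rightarrow>\<^sub>L real"
  assumes "normed_space_over scl"
  obtains F where "F \<in> dual scl" "\<And>c x. inner c (F x) = g (scl (conjugate c) x)" "norm F \<le> norm g"
proof -
  interpret normed_space_over scl by fact
  interpret scl: bounded_bilinear scl by (rule bounded_bilinear_scl)
  define f where "f x = (\<Sum>b\<in>Basis. g (scl (conjugate b) x) *\<^sub>R b)" for x
  have inner_f: "inner c (f x) = g (scl (conjugate c) x)" for c x
  proof -
    have "conjugate c = (\<Sum>b\<in>Basis. inner c b *\<^sub>R conjugate b)"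
    proof -
      have lin: "linear conjugate" by (intro linearI conjugate_add conjugate_scaleR)
      have "conjugate c = conjugate (\<Sum>b\<in>Basis. inner c b *\<^sub>R b)" by (simp add: euclidean_representation)
      then show ?thesis by (simp add: linear_sum[OF lin] conjugate_scaleR)
    qed
    then have "g (scl (conjugate c) x) = (\<Sum>b\<in>Basis. inner c b * g (scl (conjugate b) x))"
      by (simp add: scl.sum_left scl.scaleR_left blinfun.sum_right blinfun.scaleR_right)
    also have "\<dots> = inner c (f x)" by (simp add: f_def inner_sum_right mult.commute)
    finally show ?thesis by simp
  qed
  have eqI: "x = y" if "\<And>c. inner c x = inner c y" for x y :: 'k
    using that vector_eq_ldot[of x y] by blast
  have add: "f (x + y) = f x + f y" for x y
    by (rule eqI) (simp add: inner_f inner_add_right scl.add_right blinfun.add_right)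
  have scale: "f (r *\<^sub>R x) = r *\<^sub>R f x" for r x
    by (rule eqI) (simp add: inner_f scl.scaleR_right blinfun.scaleR_right)
  have bound: "norm (f x) \<le> norm g * norm x" for x
  proof (cases "f x = 0")
    case False
    have "(norm (f x))\<^sup>2 = g (scl (conjugate (f x)) x)" by (simp add: power2_norm_eq_inner inner_f)
    also have "\<dots> \<le> norm g * norm (scl (conjugate (f x)) x)"
      using norm_blinfun[of g "scl (conjugate (f x)) x"] by simp
    finally have "norm (f x) * norm (f x) \<le> norm (f x) * (norm g * norm x)"
      by (simp add: norm_scl power2_eq_square mult_ac)
    then show ?thesis using False by simp
  qed simp
  have "bounded_linear f"
    using add scale bound by (intro bounded_linear_intro[of _ "norm g"]) (simp_all add: mult.commute)
  then have app: "blinfun_apply (Blinfun f) x = f x" for x by (simp add: bounded_linear_Blinfun_apply)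
  show thesis
  proof (rule that[of "Blinfun f"])
    have "f (scl a x) = a * f x" for a x
    proof (rule eqI)
      fix c
      have "inner c (a * f x) = inner (conjugate a * c) (f x)"
        using inner_conjugate[of "conjugate a" c "f x"] by simp
      then show "inner c (f (scl a x)) = inner c (a * f x)"
        by (simp add: inner_f conjugate_mult mult.commute)
    qed
    then show "Blinfun f \<in> dual scl" by (simp add: dual_def app)
    show "inner c (Blinfun f x) = g (scl (conjugate c) x)" for c x by (simp add: app inner_f)
    show "norm (Blinfun f) \<le> norm g" using bound by (intro norm_blinfun_bound) (simp_all add: app)
  qed
qed

section \<open>Sequences without weakly Cauchy subsequences\<close>

lemma frequently_of_subseq:
  fixes r :: "nat \<Rightarrow> nat"
  assumes "strict_mono r" "\<exists>\<^sub>\<infinity>n. Q (r n)"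
  shows "\<exists>\<^sub>\<infinity>n. Q n"
  unfolding INFM_nat_le
proof
  fix m
  obtain n where "n \<ge> m" "Q (r n)" using assms(2) by (auto simp: INFM_nat_le)
  then show "\<exists>n\<ge>m. Q n" using seq_suble[OF assms(1), of n] by (auto intro!: exI[of _ "r n"])
qed

lemma frequently_shift:
  assumes "\<exists>\<^sub>\<infinity>n::nat. Q n"
  shows "\<exists>\<^sub>\<infinity>n. Q (k + n)"
  unfolding INFM_nat_le
proof
  fix m
  obtain n where "n \<ge> k + m" "Q n" using assms by (auto simp: INFM_nat_le)
  then show "\<exists>n\<ge>m. Q (k + n)" by (intro exI[of _ "n - k"]) auto
qed

lemma two_cluster_points:
  fixes f :: "nat \<Rightarrow> 'k::heine_borel"
  assumes bdd: "bounded (range f)" and nc: "\<not> convergent f"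
  obtains w1 w2 where "w1 \<noteq> w2" "\<And>e. 0 < e \<Longrightarrow> \<exists>\<^sub>\<infinity>n. dist (f n) w1 < e"
    "\<And>e. 0 < e \<Longrightarrow> \<exists>\<^sub>\<infinity>n. dist (f n) w2 < e"
proof -
  have cluster: "\<exists>w. \<forall>e>0. \<exists>\<^sub>\<infinity>n. dist (f (r n)) w < e" for r :: "nat \<Rightarrow> nat"
  proof -
    have "bounded (range (\<lambda>n. f (r n)))" by (rule bounded_subset[OF bdd]) auto
    then obtain w s where "strict_mono s" "((\<lambda>n. f (r n)) \<circ> s) \<longlonglongrightarrow> w"
      using bounded_imp_convergent_subsequence by blast
    then have w: "\<forall>\<^sub>F n in sequentially. dist (f (r (s n))) w < e" if "0 < e" for e
      using that by (auto simp: o_def tendsto_iff)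
    have "\<exists>\<^sub>\<infinity>n. dist (f (r n)) w < e" if "0 < e" for e
    proof (rule frequently_of_subseq[OF \<open>strict_mono s\<close>])
      show "\<exists>\<^sub>\<infinity>n. dist (f (r (s n))) w < e"
        using eventually_frequently[OF _ w[OF that]] by (simp add: cofinite_eq_sequentially)
    qed
    then show ?thesis by blast
  qed
  obtain w1 where w1: "\<And>e. 0 < e \<Longrightarrow> \<exists>\<^sub>\<infinity>n. dist (f n) w1 < e"
    using cluster[of "\<lambda>n. n"] by blast
  have "\<not> f \<longlonglongrightarrow> w1" using nc by (auto simp: convergent_def)
  then obtain e where e: "e > 0" "\<not> (\<forall>\<^sub>F n in sequentially. dist (f n) w1 < e)"
    by (auto simp: tendsto_iff)
  then have "\<exists>\<^sub>\<infinity>n. dist (f n) w1 \<ge> e"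
    by (simp add: not_eventually not_less cofinite_eq_sequentially)
  then obtain r :: "nat \<Rightarrow> nat" where r: "strict_mono r" "\<And>n. dist (f (r n)) w1 \<ge> e"
    using greedy_subsequence[of "\<lambda>_ n. dist (f n) w1 \<ge> e"] by blast
  obtain w2 where w2: "\<And>e. 0 < e \<Longrightarrow> \<exists>\<^sub>\<infinity>n. dist (f (r n)) w2 < e"
    using cluster[of r] by blast
  have "w1 \<noteq> w2" using w2[OF e(1)] r(2) by (auto simp: not_le[symmetric])
  moreover have "\<exists>\<^sub>\<infinity>n. dist (f n) w2 < e'" if "0 < e'" for e'
    by (rule frequently_of_subseq[OF r(1) w2[OF that]])
  ultimately show thesis using w1 by (intro that)
qed

text \<open>
  The difference of a point of \<open>disc z w\<close> and a point of \<open>disc w z\<close> equals \<open>z - w\<close> up to a fraction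
  \<open>1 / (2 * DIM('k))\<close> of its norm. The rotation to real parts in \<open>sum_norm_le_inner_one\<close> costs a factor
  \<open>DIM('k)\<close>, so half of the main term survives.
\<close>

definition disc :: "'k \<Rightarrow> 'k \<Rightarrow> 'k::euclidean_space set" where
  "disc z w = ball z (dist z w / (4 * DIM('k)))"

lemma nonconvergent_oscillates:
  fixes f :: "nat \<Rightarrow> 'k::euclidean_space"
  assumes D: "\<And>X. open X \<Longrightarrow> X \<noteq> {} \<Longrightarrow> \<exists>d\<in>D. d \<in> X"
    and bdd: "bounded (range f)" and nc: "\<not> convergent f"
  obtains z w where "z \<in> D" "w \<in> D" "\<exists>\<^sub>\<infinity>n. f n \<in> disc z w" "\<exists>\<^sub>\<infinity>n. f n \<in> disc w z"
proof -
  obtain w1 w2 where w: "w1 \<noteq> w2" "\<And>e. 0 < e \<Longrightarrow> \<exists>\<^sub>\<infinity>n. dist (f n) w1 < e"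
    "\<And>e. 0 < e \<Longrightarrow> \<exists>\<^sub>\<infinity>n. dist (f n) w2 < e"
    using two_cluster_points[OF bdd nc] by blast
  define N where "N = real DIM('k)"
  have N: "N \<ge> 1" by (simp add: N_def Suc_leI)
  \<comment> \<open>The discs around any points within \<open>e\<close> of \<open>w1\<close> and \<open>w2\<close> contain the balls of radius \<open>e\<close> around \<open>w1\<close> and \<open>w2\<close>.\<close>
  define e where "e = dist w1 w2 / (16 * N)"
  have e: "0 < e" using w(1) N by (simp add: e_def)
  obtain z1 where z1: "z1 \<in> D" "dist w1 z1 < e" using D[of "ball w1 e"] e by auto
  obtain z2 where z2: "z2 \<in> D" "dist w2 z2 < e" using D[of "ball w2 e"] e by auto
  have "16 * e \<le> dist w1 w2"
    using N mult_left_mono[of 1 N "dist w1 w2"] by (simp add: e_def field_simps)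
  then have "dist w1 w2 / 2 \<le> dist z1 z2"
    using dist_triangle[of w1 w2 z1] dist_triangle[of z1 w2 z2] z1(2) z2(2)
      zero_le_dist[of w1 w2] dist_commute[of z2 w2] by linarith
  then have rad: "2 * e \<le> dist z1 z2 / (4 * N)" using N by (simp add: e_def field_simps)
  have "\<exists>\<^sub>\<infinity>n. f n \<in> disc z1 z2"
    using w(2)[OF e]
  proof (rule frequently_elim1)
    fix n assume "dist (f n) w1 < e"
    then show "f n \<in> disc z1 z2"
      using dist_triangle[of z1 "f n" w1] z1(2) rad by (simp add: disc_def N_def dist_commute)
  qed
  moreover have "\<exists>\<^sub>\<infinity>n. f n \<in> disc z2 z1"
    using w(3)[OF e]
  proof (rule frequently_elim1)
    fix n assume "dist (f n) w2 < e"
    then show "f n \<in> disc z2 z1"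
      using dist_triangle[of z2 "f n" w2] z2(2) rad by (simp add: disc_def N_def dist_commute)
  qed
  ultimately show thesis using z1(1) z2(1) by (intro that)
qed

text \<open>
  A diagonal argument over the countably many pairs of discs with centres in a dense set. If for every
  pair one could pass to a subsequence on which no \<open>i\<close> oscillates between the two discs, the diagonal
  subsequence would make \<open>h i\<close> convergent for every \<open>i\<close>.
\<close>

lemma uniformly_oscillating_subsequence:
  fixes h :: "'i \<Rightarrow> nat \<Rightarrow> 'k::euclidean_space"
  assumes bdd: "\<And>i. i \<in> \<Gamma> \<Longrightarrow> bounded (range (h i))"
    and nc: "\<And>r :: nat \<Rightarrow> nat. strict_mono r \<Longrightarrow> \<exists>i\<in>\<Gamma>. \<not> convergent (\<lambda>n. h i (r n))"
  obtains z w and s :: "nat \<Rightarrow> nat" where "strict_mono s"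
    "\<And>r :: nat \<Rightarrow> nat. strict_mono r \<Longrightarrow>
       \<exists>i\<in>\<Gamma>. (\<exists>\<^sub>\<infinity>n. h i (s (r n)) \<in> disc z w) \<and> (\<exists>\<^sub>\<infinity>n. h i (s (r n)) \<in> disc w z)"
proof (rule ccontr)
  assume not_thesis: "\<not> thesis"
  note conclude = that
  define osc where "osc z w s \<longleftrightarrow>
      (\<exists>i\<in>\<Gamma>. (\<exists>\<^sub>\<infinity>n. h i (s n) \<in> disc z w) \<and> (\<exists>\<^sub>\<infinity>n. h i (s n) \<in> disc w z))"
    for z w and s :: "nat \<Rightarrow> nat"
  have neg: "\<exists>r. strict_mono r \<and> \<not> osc z w (s \<circ> r)" if "strict_mono s" for z w and s :: "nat \<Rightarrow> nat"
    using not_thesis conclude[OF that, of z w] unfolding osc_def o_def by blast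
  obtain D :: "'k set" where D: "countable D" "\<And>X. open X \<Longrightarrow> X \<noteq> {} \<Longrightarrow> \<exists>d\<in>D. d \<in> X"
    using countable_dense_setE by blast
  have "D \<noteq> {}" using D(2)[of UNIV] by auto
  define pr where "pr = from_nat_into (D \<times> D)"
  have pr: "\<exists>n. pr n = (z, w)" if "z \<in> D" "w \<in> D" for z w
    unfolding pr_def using from_nat_into_surj[of "D \<times> D" "(z, w)"] D(1) that by auto
  define P where "P n s \<longleftrightarrow> \<not> osc (fst (pr n)) (snd (pr n)) s" for n s
  interpret subseqs P
    by unfold_locales (simp only: P_def neg)
  have no_osc: "P k (diagseq \<circ> (+) (Suc k))" for k
  proof (rule diagseq_holds)
    fix r s :: "nat \<Rightarrow> nat" and n
    assume "strict_mono r" "P n s"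
    then show "P n (s \<circ> r)"
      unfolding P_def osc_def o_def using frequently_of_subseq[OF \<open>strict_mono r\<close>] by fast
  qed
  obtain i where i: "i \<in> \<Gamma>" "\<not> convergent (\<lambda>n. h i (diagseq n))"
    using nc[OF subseq_diagseq] by blast
  have "bounded (range (\<lambda>n. h i (diagseq n)))" by (rule bounded_subset[OF bdd[OF i(1)]]) auto
  from nonconvergent_oscillates[OF D(2) this i(2)]
  obtain z w where zw: "z \<in> D" "w \<in> D" "\<exists>\<^sub>\<infinity>n. h i (diagseq n) \<in> disc z w"
    "\<exists>\<^sub>\<infinity>n. h i (diagseq n) \<in> disc w z" by blast
  obtain k where "pr k = (z, w)" using pr[OF zw(1,2)] by blast
  then have "\<not> osc z w (\<lambda>n. diagseq (Suc k + n))"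
    using no_osc[of k] by (simp only: P_def o_def fst_conv snd_conv not_False_eq_True)
  moreover have "osc z w (\<lambda>n. diagseq (Suc k + n))"
    unfolding osc_def
    using i(1) frequently_shift[OF zw(3), of "Suc k"] frequently_shift[OF zw(4), of "Suc k"] by blast
  ultimately show False by contradiction
qed

text \<open>
  The Ramsey theorem is applied to the set of sequences each of whose finite initial parts alternates
  between \<open>A\<close> and \<open>B\<close> for some \<open>i\<close>. By the oscillation hypothesis, every sequence has a subsequence in
  this set, so all subsequences of some \<open>l\<close> are in it. An arbitrary pattern of \<open>A\<close> and \<open>B\<close> on the middle members of
  consecutive triples of \<open>l\<close> is part of an alternating pattern on a subsequence: add to each middle
  member its successor or its predecessor, so that it gets an even or an odd position.
\<close>

lemma independent_subsequence:
  fixes h :: "'i \<Rightarrow> nat \<Rightarrow> 'b"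
  assumes osc: "\<And>r :: nat \<Rightarrow> nat. strict_mono r \<Longrightarrow>
     \<exists>i\<in>\<Gamma>. (\<exists>\<^sub>\<infinity>n. h i (r n) \<in> A) \<and> (\<exists>\<^sub>\<infinity>n. h i (r n) \<in> B)"
  obtains l :: "nat \<Rightarrow> nat" where "\<And>(\<sigma> :: nat \<Rightarrow> bool) n. \<exists>i\<in>\<Gamma>. \<forall>j<n. h i (l j) \<in> (if \<sigma> j then A else B)"
proof -
  define T where "T = {t. \<exists>i\<in>\<Gamma>. \<forall>j<length t. h i (t ! j) \<in> (if even j then A else B)}"
  obtain l :: "nat \<Rightarrow> nat" where l: "strict_mono l"
    "(\<forall>r. strict_mono r \<longrightarrow> (\<forall>k. map (\<lambda>i. l (r i)) [0..<k] \<in> T)) \<or>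
     (\<forall>r. strict_mono r \<longrightarrow> (\<exists>k. map (\<lambda>i. l (r i)) [0..<k] \<notin> T))"
    by (rule nash_williams)
  have "\<not> (\<forall>r. strict_mono r \<longrightarrow> (\<exists>k. map (\<lambda>i. l (r i)) [0..<k] \<notin> T))"
  proof -
    obtain i where i: "i \<in> \<Gamma>" "\<exists>\<^sub>\<infinity>n. h i (l n) \<in> A" "\<exists>\<^sub>\<infinity>n. h i (l n) \<in> B"
      using osc[OF l(1)] by blast
    define Q where "Q F n \<longleftrightarrow> h i (l n) \<in> (if even (card F) then A else B)" for F :: "nat set" and n
    have "\<exists>\<^sub>\<infinity>n. Q F n" for F using i by (auto simp: Q_def)
    then obtain r :: "nat \<Rightarrow> nat" where r: "strict_mono r" "\<And>n. Q (r ` {..<n}) (r n)"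
      using greedy_subsequence[of Q] by blast
    have "card (r ` {..<n}) = n" for n
      using strict_mono_imp_inj_on[OF r(1)] by (simp add: card_image inj_on_subset)
    with r(2) have "h i (l (r n)) \<in> (if even n then A else B)" for n unfolding Q_def by metis
    then have "map (\<lambda>i. l (r i)) [0..<k] \<in> T" for k
      unfolding T_def by (intro CollectI bexI[OF _ i(1)]) simp
    with r(1) show ?thesis by blast
  qed
  with l(2) have T: "map (\<lambda>i. l (r i)) [0..<k] \<in> T" if "strict_mono r" for r k using that by blast
  show thesis
  proof (rule that[of "\<lambda>j. l (3 * j + 1)"])
    fix \<sigma> :: "nat \<Rightarrow> bool" and n
    \<comment> \<open>Positions \<open>2 * j\<close> and \<open>2 * j + 1\<close> go to two neighbours in the triple starting at \<open>3 * j\<close>.\<close>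
    define r where "r k = 3 * (k div 2) + (if \<sigma> (k div 2) then k mod 2 + 1 else k mod 2)" for k
    have "strict_mono r"
      unfolding strict_mono_Suc_iff
    proof
      fix k show "r k < r (Suc k)"
        by (cases "even k") (auto elim!: evenE oddE simp: r_def)
    qed
    from T[OF this, of "2 * n"] obtain i where i: "i \<in> \<Gamma>"
      "\<And>k. k < 2 * n \<Longrightarrow> h i (l (r k)) \<in> (if even k then A else B)"
      unfolding T_def by auto
    have "h i (l (3 * j + 1)) \<in> (if \<sigma> j then A else B)" if "j < n" for j
      using i(2)[of "if \<sigma> j then 2 * j else 2 * j + 1"] that by (auto simp: r_def split: if_splits)
    with i(1) show "\<exists>i\<in>\<Gamma>. \<forall>j<n. h i (l (3 * j + 1)) \<in> (if \<sigma> j then A else B)" by blast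
  qed
qed

text \<open>
  A sequence in the unit ball without weakly Cauchy subsequences has a subsequence equivalent to the
  basis of \<open>l1\<close>. Independence provides functionals \<open>F\<close> and \<open>G\<close> in the dual ball such that
  \<open>F (v j) - G (v j)\<close> is close to \<open>\<plusminus> (z - w)\<close>, with signs that may be chosen for each \<open>j\<close>. The signs are
  those of the real parts of \<open>c j * (z - w)\<close>, after a rotation that makes the sum of the absolute real
  parts comparable to the sum of the norms; then \<open>F - G\<close> is large at \<open>\<Sum>j. c j * v j\<close>.
\<close>

theorem rosenthal_dor:
  fixes scl :: "'k::{real_normed_field,euclidean_space} \<Rightarrow> 'a::real_normed_vector \<Rightarrow> 'a"
  assumes "normed_space_over scl" and x: "\<And>n. norm (x n) \<le> 1"
    and nc: "\<And>r :: nat \<Rightarrow> nat. strict_mono r \<Longrightarrow> \<exists>F\<in>dual scl. \<not> convergent (\<lambda>n. F (x (r n)))"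
  obtains v and \<kappa> :: real where "0 < \<kappa>" "\<And>n. norm (v n) \<le> 1"
    "\<And>(c :: nat \<Rightarrow> 'k) n. \<kappa> * (\<Sum>j<n. norm (c j)) \<le> norm (\<Sum>j<n. scl (c j) (v j))"
proof -
  interpret normed_space_over scl by fact
  define \<Gamma> where "\<Gamma> = {F \<in> dual scl. norm F \<le> 1}"
  have nc': "\<exists>F\<in>\<Gamma>. \<not> convergent (\<lambda>n. F (x (r n)))" if r: "strict_mono r" for r :: "nat \<Rightarrow> nat"
  proof -
    obtain F where F: "F \<in> dual scl" "\<not> convergent (\<lambda>n. F (x (r n)))" using nc[OF r] by blast
    have "norm F \<noteq> 0" using F(2) by (auto simp: convergent_const)
    have "\<not> convergent (\<lambda>n. (inverse (norm F) *\<^sub>R F) (x (r n)))"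
    proof
      assume "convergent (\<lambda>n. (inverse (norm F) *\<^sub>R F) (x (r n)))"
      then obtain L where "(\<lambda>n. (inverse (norm F) *\<^sub>R F) (x (r n))) \<longlonglongrightarrow> L"
        by (auto simp: convergent_def)
      from tendsto_scaleR[OF tendsto_const[of "norm F"] this] show False
        using F(2) \<open>norm F \<noteq> 0\<close> by (auto simp: blinfun.scaleR_left convergent_def)
    qed
    moreover have "inverse (norm F) *\<^sub>R F \<in> \<Gamma>"
      using F(1) \<open>norm F \<noteq> 0\<close> by (auto simp: \<Gamma>_def dual_def blinfun.scaleR_left)
    ultimately show ?thesis by blast
  qed
  have le: "norm (F (x n)) \<le> 1" if "F \<in> \<Gamma>" for F n
    using norm_blinfun[of F "x n"] mult_mono[of "norm F" 1 "norm (x n)" 1] x[of n] that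
    by (simp add: \<Gamma>_def)
  have bd: "bounded (range (\<lambda>n. F (x n)))" if "F \<in> \<Gamma>" for F
    using le[OF that] by (intro boundedI) auto
  obtain z w and s :: "nat \<Rightarrow> nat" where s: "strict_mono s"
    "\<And>r :: nat \<Rightarrow> nat. strict_mono r \<Longrightarrow> \<exists>F\<in>\<Gamma>. (\<exists>\<^sub>\<infinity>n. F (x (s (r n))) \<in> disc z w) \<and>
      (\<exists>\<^sub>\<infinity>n. F (x (s (r n))) \<in> disc w z)"
    by (rule uniformly_oscillating_subsequence[of \<Gamma> "\<lambda>F n. blinfun_apply F (x n)", OF bd nc'],
        assumption, assumption) (rule that)
  obtain l :: "nat \<Rightarrow> nat" where l: "\<And>(\<sigma> :: nat \<Rightarrow> bool) n.
      \<exists>F\<in>\<Gamma>. \<forall>j<n. F (x (s (l j))) \<in> (if \<sigma> j then disc z w else disc w z)"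
    by (rule independent_subsequence[of \<Gamma> "\<lambda>F n. blinfun_apply F (x (s n))" "disc z w" "disc w z",
          OF s(2)], assumption) (rule that)
  define v where "v j = x (s (l j))" for j
  define N where "N = real DIM('k)"
  define d where "d = dist z w"
  have N: "0 < N" by (simp add: N_def)
  have "d \<noteq> 0"
    using l[of 1 "\<lambda>_. True"] by (auto simp: disc_def d_def)
  then have d: "0 < d" by (simp add: d_def)
  have dwz: "dist w z = d" by (simp add: d_def dist_commute)
  show thesis
  proof (rule that)
    show "0 < d / (4 * N)" using d N by simp
    show "norm (v n) \<le> 1" for n by (simp add: v_def x)
    fix c :: "nat \<Rightarrow> 'k" and n
    obtain b where b: "norm b = 1"
      "(\<Sum>j<n. norm (c j * (z - w))) \<le> N * (\<Sum>j<n. \<bar>inner 1 (b * (c j * (z - w)))\<bar>)"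
      using sum_norm_le_inner_one[of "\<lambda>j. c j * (z - w)" "{..<n}"] unfolding N_def by blast
    define \<sigma> where "\<sigma> j \<longleftrightarrow> inner 1 (b * (c j * (z - w))) \<ge> 0" for j
    obtain F where F: "F \<in> \<Gamma>" "\<And>j. j < n \<Longrightarrow> F (v j) \<in> (if \<sigma> j then disc z w else disc w z)"
      using l[of n \<sigma>] unfolding v_def by blast
    obtain G where G: "G \<in> \<Gamma>" "\<And>j. j < n \<Longrightarrow> G (v j) \<in> (if \<not> \<sigma> j then disc z w else disc w z)"
      using l[of n "\<lambda>j. \<not> \<sigma> j"] unfolding v_def by blast
    define S where "S = (\<Sum>j<n. scl (c j) (v j))"
    have term_le: "\<bar>inner 1 (b * (c j * (z - w)))\<bar> - norm (c j) * (d / (2 * N))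
        \<le> inner 1 (b * (c j * (F (v j) - G (v j))))" if j: "j < n" for j
    proof -
      define e where "e = F (v j) - G (v j) - (if \<sigma> j then z - w else w - z)"
      have "norm e \<le> d / (4 * N) + d / (4 * N)"
      proof (cases "\<sigma> j")
        case True
        then have "norm (F (v j) - z) < d / (4 * N)" "norm (G (v j) - w) < d / (4 * N)"
          using F(2)[OF j] G(2)[OF j] dwz
          by (auto simp: disc_def N_def d_def dist_norm norm_minus_commute)
        moreover have "e = (F (v j) - z) - (G (v j) - w)" using True by (simp add: e_def)
        ultimately show ?thesis using norm_triangle_ineq4[of "F (v j) - z" "G (v j) - w"] by simp
      next
        case False
        then have "norm (F (v j) - w) < d / (4 * N)" "norm (G (v j) - z) < d / (4 * N)"
          using F(2)[OF j] G(2)[OF j] dwz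
          by (auto simp: disc_def N_def d_def dist_norm norm_minus_commute)
        moreover have "e = (F (v j) - w) - (G (v j) - z)" using False by (simp add: e_def)
        ultimately show ?thesis using norm_triangle_ineq4[of "F (v j) - w" "G (v j) - z"] by simp
      qed
      then have e: "norm e \<le> d / (2 * N)" by (simp add: field_simps)
      have "\<bar>inner 1 (b * (c j * e))\<bar> \<le> norm (1::'k) * norm (b * (c j * e))"
        by (rule Cauchy_Schwarz_ineq2)
      also have "\<dots> = norm (c j) * norm e" by (simp add: norm_mult b(1))
      also have "\<dots> \<le> norm (c j) * (d / (2 * N))" by (rule mult_left_mono[OF e]) simp
      finally have le: "\<bar>inner 1 (b * (c j * e))\<bar> \<le> norm (c j) * (d / (2 * N))" .
      have eq: "F (v j) - G (v j) = (if \<sigma> j then z - w else - (z - w)) + e" by (simp add: e_def)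
      have "inner 1 (b * (c j * (F (v j) - G (v j)))) =
          inner 1 (b * (c j * (if \<sigma> j then z - w else - (z - w)))) + inner 1 (b * (c j * e))"
        by (simp only: eq distrib_left inner_add_right)
      also have "inner 1 (b * (c j * (if \<sigma> j then z - w else - (z - w)))) = \<bar>inner 1 (b * (c j * (z - w)))\<bar>"
        by (auto simp: \<sigma>_def simp del: minus_diff_eq)
      finally have "inner 1 (b * (c j * (F (v j) - G (v j)))) =
          \<bar>inner 1 (b * (c j * (z - w)))\<bar> + inner 1 (b * (c j * e))" .
      with le show ?thesis by linarith
    qed
    have FG: "F (scl a y) = a * F y" "G (scl a y) = a * G y" for a y
      using F(1) G(1) by (auto simp: \<Gamma>_def dual_def)
    have "(\<Sum>j<n. norm (c j)) * d = (\<Sum>j<n. norm (c j * (z - w)))"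
      by (simp add: norm_mult d_def dist_norm sum_distrib_right)
    with b(2) N have "(\<Sum>j<n. norm (c j)) * (d / N) \<le> (\<Sum>j<n. \<bar>inner 1 (b * (c j * (z - w)))\<bar>)"
      by (simp add: field_simps)
    moreover have "(\<Sum>j<n. norm (c j)) * (d / N) = 2 * ((\<Sum>j<n. norm (c j)) * (d / (2 * N)))"
      using N by (simp add: field_simps)
    ultimately have "(\<Sum>j<n. norm (c j)) * (d / (2 * N)) \<le>
        (\<Sum>j<n. \<bar>inner 1 (b * (c j * (z - w)))\<bar> - norm (c j) * (d / (2 * N)))"
      by (subst sum_subtractf, subst sum_distrib_right[symmetric]) linarith
    also have "\<dots> \<le> (\<Sum>j<n. inner 1 (b * (c j * (F (v j) - G (v j)))))"
      by (intro sum_mono term_le) simp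
    also have "\<dots> = inner 1 (b * (F S - G S))"
      by (simp add: S_def blinfun.sum_right FG inner_sum_right sum_distrib_left right_diff_distrib
          sum_subtractf inner_diff_right)
    also have "\<dots> \<le> norm (1::'k) * norm (b * (F S - G S))" by (rule norm_cauchy_schwarz)
    also have "\<dots> = norm (F S - G S)" by (simp add: norm_mult b(1))
    also have "\<dots> \<le> norm (F S) + norm (G S)" by (rule norm_triangle_ineq4)
    also have "\<dots> \<le> norm S + norm S"
    proof (rule add_mono)
      show "norm (F S) \<le> norm S"
        using order.trans[OF norm_blinfun[of F S] mult_right_mono[of "norm F" 1 "norm S"]] F(1)
        by (simp add: \<Gamma>_def)
      show "norm (G S) \<le> norm S"
        using order.trans[OF norm_blinfun[of G S] mult_right_mono[of "norm G" 1 "norm S"]] G(1)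
        by (simp add: \<Gamma>_def)
    qed
    finally show "d / (4 * N) * (\<Sum>j<n. norm (c j)) \<le> norm (\<Sum>j<n. scl (c j) (v j))"
      using N by (simp add: S_def field_simps)
  qed
qed

lemma l1_isomorphicI:
  fixes scl :: "'k::{real_normed_field,euclidean_space} \<Rightarrow> 'a::banach \<Rightarrow> 'a"
  assumes "normed_space_over scl" and \<kappa>: "0 < \<kappa>" and v: "\<And>n. norm (v n) \<le> 1"
    and lower: "\<And>(c :: nat \<Rightarrow> 'k) n. \<kappa> * (\<Sum>j<n. norm (c j)) \<le> norm (\<Sum>j<n. scl (c j) (v j))"
  shows "l1_isomorphic_to_subspace scl"
proof -
  interpret normed_space_over scl by fact
  interpret scl: bounded_bilinear scl by (rule bounded_bilinear_scl)
  define T where "T a = (\<Sum>n. scl (l1_nth a n) (v n))" for a :: "'k l1"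
  have le: "norm (scl (l1_nth a n) (v n)) \<le> norm (l1_nth a n)" for a n
    using mult_left_mono[OF v[of n], of "norm (l1_nth a n)"] by (simp add: norm_scl)
  have summ: "summable (\<lambda>n. scl (l1_nth a n) (v n))" for a :: "'k l1"
    by (rule summable_comparison_test'[OF summable_l1 le])
  have add: "T (a + b) = T a + T b" for a b
    unfolding T_def by (simp add: plus_l1.rep_eq scl.add_left suminf_add[OF summ summ])
  have scaleR: "T (r *\<^sub>R a) = r *\<^sub>R T a" for r a
    unfolding T_def by (simp add: scaleR_l1.rep_eq scl.scaleR_left suminf_scaleR_right[OF summ])
  have scale: "T (scale_l1 c a) = scl c (T a)" for c a
  proof -
    have "T (scale_l1 c a) = (\<Sum>n. scl c (scl (l1_nth a n) (v n)))"
      by (simp add: T_def scale_l1.rep_eq)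
    also have "\<dots> = scl c (T a)"
      unfolding T_def by (rule bounded_linear.suminf[OF scl.bounded_linear_right summ, symmetric])
    finally show ?thesis .
  qed
  have upper: "norm (T a) \<le> norm a * 1" for a
    unfolding T_def norm_l1.rep_eq using norm_suminf_le[OF le summable_l1] by simp
  have T: "bounded_linear T" by (rule bounded_linear_intro[OF add scaleR upper])
  have low: "\<kappa> * norm a \<le> norm (T a)" for a
  proof (rule LIMSEQ_le)
    show "(\<lambda>n. \<kappa> * (\<Sum>j<n. norm (l1_nth a j))) \<longlonglongrightarrow> \<kappa> * norm a"
      unfolding norm_l1.rep_eq by (intro tendsto_mult_left summable_LIMSEQ summable_l1)
    show "(\<lambda>n. norm (\<Sum>j<n. scl (l1_nth a j) (v j))) \<longlonglongrightarrow> norm (T a)"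
      unfolding T_def by (intro tendsto_norm summable_LIMSEQ summ)
  qed (use lower in blast)
  have dist: "dist a b \<le> inverse \<kappa> * dist (T a) (T b)" for a b
    using low[of "a - b"] \<kappa> by (simp add: dist_norm linear_diff[OF bounded_linear.linear[OF T]] field_simps)
  have inj: "inj T"
  proof (rule injI)
    fix a b assume "T a = T b"
    then show "a = b" using dist[of a b] by simp
  qed
  have "continuous_on (range T) (inv T)"
  proof (rule lipschitz_on_continuous_on)
    show "(inverse \<kappa>)-lipschitz_on (range T) (inv T)"
      using dist \<kappa> by (intro lipschitz_onI) (auto simp: inv_f_f[OF inj])
  qed
  then have "homeomorphism UNIV (range T) T (inv T)"
    unfolding homeomorphism_def using linear_continuous_on[OF T]
    by (auto simp: inv_f_f[OF inj] inj_imp_surj_inv[OF inj] image_comp)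
  with T scale show ?thesis unfolding l1_isomorphic_to_subspace_def by blast
qed

section \<open>Spaces without a copy of the space of absolutely summable sequences\<close>

text \<open>
  Bounds on the partial sums, rather than on the infinite sum, show at once that the ball is closed
  in the topology of pointwise convergence.
\<close>

definition unit_l1_ball :: "(nat \<Rightarrow> 'k::real_normed_vector) set" where
  "unit_l1_ball = {a. \<forall>n. (\<Sum>k<n. norm (a k)) \<le> 1}"

lemma compact_unit_l1_ball: "compact (unit_l1_ball :: (nat \<Rightarrow> 'k::{real_normed_vector,heine_borel}) set)"
proof -
  have "compactin (product_topology (\<lambda>_. euclidean) UNIV) (PiE UNIV (\<lambda>_::nat. cball (0::'k) 1))"
    by (simp add: compactin_PiE)
  then have "compact (PiE UNIV (\<lambda>_::nat. cball (0::'k) 1))"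
    by (simp add: euclidean_product_topology)
  moreover have "closed (unit_l1_ball :: (nat \<Rightarrow> 'k) set)"
    unfolding unit_l1_ball_def
    by (intro closed_Collect_all closed_Collect_le continuous_on_sum continuous_on_norm
        continuous_on_product_coordinates continuous_on_const)
  moreover have "(unit_l1_ball :: (nat \<Rightarrow> 'k) set) \<subseteq> PiE UNIV (\<lambda>_. cball 0 1)"
  proof
    fix a :: "nat \<Rightarrow> 'k" assume "a \<in> unit_l1_ball"
    then have sum_le: "(\<Sum>i<n. norm (a i)) \<le> 1" for n by (simp add: unit_l1_ball_def)
    have "norm (a k) \<le> 1" for k
    proof -
      have "norm (a k) \<le> (\<Sum>i<Suc k. norm (a i))" by (rule member_le_sum) auto
      also have "\<dots> \<le> 1" by (rule sum_le)
      finally show ?thesis .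
    qed
    then show "a \<in> PiE UNIV (\<lambda>_. cball 0 1)" by (auto simp: PiE_iff extensional_def)
  qed
  ultimately show ?thesis using compact_Int_closed by (metis inf.absorb2)
qed

lemma unit_l1_ball_summable:
  assumes "a \<in> unit_l1_ball" shows "summable (\<lambda>n. norm (a n))"
  using assms by (intro summableI_nonneg_bounded[of _ 1]) (auto simp: unit_l1_ball_def)

text \<open>
  A functional \<open>F\<close> takes the value \<open>\<Sum>n. a n * F (y n)\<close> at the sum \<open>\<Phi> a\<close>. As \<open>F (y n)\<close> tends to zero,
  the partial sums converge uniformly on the unit ball of \<open>l1\<close>, so this value depends continuously on
  \<open>a\<close> in the topology of pointwise convergence, in which the ball is compact.
\<close>

lemma weakly_null_hull:
  fixes scl :: "'k::{real_normed_field,euclidean_space} \<Rightarrow> 'a::banach \<Rightarrow> 'a"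
  assumes "normed_space_over scl" and bdd: "\<And>k. norm (y k) \<le> C"
    and null: "\<And>F. F \<in> dual scl \<Longrightarrow> (\<lambda>k. F (y k)) \<longlonglongrightarrow> 0"
  obtains K where "compactin (weak_topology scl) K" "absolutely_convex scl K" "range y \<subseteq> K"
proof -
  interpret normed_space_over scl by fact
  interpret scl: bounded_bilinear scl by (rule bounded_bilinear_scl)
  define A where "A = (unit_l1_ball :: (nat \<Rightarrow> 'k) set)"
  define \<Phi> where "\<Phi> a = (\<Sum>n. scl (a n) (y n))" for a
  have summ: "summable (\<lambda>n. scl (a n) (y n))" if "a \<in> A" for a
  proof (rule summable_comparison_test')
    show "summable (\<lambda>n. norm (a n) * C)"
      using that unit_l1_ball_summable unfolding A_def by (intro summable_mult2) blast
    show "norm (scl (a n) (y n)) \<le> norm (a n) * C" for n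
      by (simp add: norm_scl mult_left_mono bdd)
  qed
  have cont: "continuous_on A (\<lambda>a. F (\<Phi> a))" if F: "F \<in> dual scl" for F
  proof (rule uniform_limit_theorem)
    show "\<forall>\<^sub>F N in sequentially. continuous_on A (\<lambda>a. \<Sum>n<N. a n * F (y n))"
      by (intro always_eventually allI continuous_intros)
        (rule continuous_on_subset[OF continuous_on_product_coordinates subset_UNIV])
    show "uniform_limit A (\<lambda>N a. \<Sum>n<N. a n * F (y n)) (\<lambda>a. F (\<Phi> a)) sequentially"
      unfolding uniform_limit_iff
    proof (intro allI impI)
      fix e :: real assume e: "0 < e"
      then have "\<forall>\<^sub>F n in sequentially. norm (F (y n)) < e / 2"
        using tendstoD[OF null[OF F], of "e / 2"] by simp
      then obtain N where N: "\<And>n. n \<ge> N \<Longrightarrow> norm (F (y n)) < e / 2"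
        by (auto simp: eventually_sequentially)
      have "dist (\<Sum>n<M. a n * F (y n)) (F (\<Phi> a)) < e" if M: "M \<ge> N" and a: "a \<in> A" for M a
      proof -
        have "(\<lambda>n. F (scl (a n) (y n))) sums F (\<Phi> a)"
          unfolding \<Phi>_def by (intro bounded_linear.sums[OF blinfun.bounded_linear_right] summable_sums summ a)
        then have "(\<lambda>n. a n * F (y n)) sums F (\<Phi> a)" using F by (simp add: dual_def)
        then have lim: "(\<lambda>L. \<Sum>n<L. a n * F (y n)) \<longlonglongrightarrow> F (\<Phi> a)" by (simp add: sums_def)
        have "norm ((\<Sum>n<L. a n * F (y n)) - (\<Sum>n<M. a n * F (y n))) \<le> e / 2" if L: "L \<ge> M" for L
        proof -
          have "(\<Sum>n<L. a n * F (y n)) - (\<Sum>n<M. a n * F (y n)) = (\<Sum>n\<in>{M..<L}. a n * F (y n))"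
            using sum_diff_nat_ivl[of 0 M L "\<lambda>n. a n * F (y n)"] L by (simp add: atLeast0LessThan)
          also have "norm \<dots> \<le> (\<Sum>n\<in>{M..<L}. norm (a n) * (e / 2))"
          proof (rule sum_norm_le)
            fix n assume "n \<in> {M..<L}"
            then have "norm (F (y n)) \<le> e / 2" using N[of n] M by simp
            then show "norm (a n * F (y n)) \<le> norm (a n) * (e / 2)"
              unfolding norm_mult by (rule mult_left_mono) simp
          qed
          also have "\<dots> \<le> (\<Sum>n<L. norm (a n) * (e / 2))"
            using e by (intro sum_mono2) auto
          also have "\<dots> = (\<Sum>n<L. norm (a n)) * (e / 2)" by (simp add: sum_distrib_right)
          also have "\<dots> \<le> 1 * (e / 2)"
            using a e by (intro mult_right_mono) (auto simp: A_def unit_l1_ball_def)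
          finally show ?thesis by simp
        qed
        then have "norm (F (\<Phi> a) - (\<Sum>n<M. a n * F (y n))) \<le> e / 2"
          by (intro LIMSEQ_le_const2[OF tendsto_norm[OF tendsto_diff[OF lim tendsto_const]]]) blast
        then show ?thesis using e by (simp add: dist_norm norm_minus_commute)
      qed
      then show "\<forall>\<^sub>F M in sequentially. \<forall>a\<in>A. dist (\<Sum>n<M. a n * F (y n)) (F (\<Phi> a)) < e"
        by (auto simp: eventually_sequentially)
    qed
  qed simp
  show thesis
  proof (rule that)
    have "continuous_map (top_of_set A) (weak_topology scl) \<Phi>"
      unfolding weak_topology_def
    proof (rule continuous_on_generated_topo)
      fix V assume "V \<in> {blinfun_apply f -` U |f U. f \<in> dual scl \<and> open U}"
      then obtain F U where FU: "F \<in> dual scl" "open U" "V = blinfun_apply F -` U" by blast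
      have "\<Phi> -` V \<inter> topspace (top_of_set A) = A \<inter> (\<lambda>a. F (\<Phi> a)) -` U" using FU by auto
      then show "openin (top_of_set A) (\<Phi> -` V \<inter> topspace (top_of_set A))"
        using continuous_openin_preimage_gen[OF cont[OF FU(1)] FU(2)] by simp
    next
      have "0 \<in> dual scl" by (simp add: dual_def)
      then show "\<Phi> ` topspace (top_of_set A) \<subseteq> \<Union> {blinfun_apply f -` U |f U. f \<in> dual scl \<and> open U}"
        by (force intro: exI[of _ UNIV])
    qed
    moreover have "compactin (top_of_set A) A"
      using compact_unit_l1_ball by (simp add: A_def compactin_subtopology)
    ultimately show "compactin (weak_topology scl) (\<Phi> ` A)" by (rule image_compactin[rotated])
  next
    show "absolutely_convex scl (\<Phi> ` A)"
      unfolding absolutely_convex_def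
    proof (intro ballI allI impI)
      fix u v and c d :: 'k
      assume "u \<in> \<Phi> ` A" "v \<in> \<Phi> ` A" and cd: "norm c + norm d \<le> 1"
      then obtain a b where ab: "a \<in> A" "b \<in> A" "u = \<Phi> a" "v = \<Phi> b" by blast
      have "scl c u + scl d v = (\<Sum>n. scl c (scl (a n) (y n))) + (\<Sum>n. scl d (scl (b n) (y n)))"
        unfolding ab \<Phi>_def
        by (simp only: bounded_linear.suminf[OF scl.bounded_linear_right summ[OF ab(1)]]
            bounded_linear.suminf[OF scl.bounded_linear_right summ[OF ab(2)]])
      also have "\<dots> = (\<Sum>n. scl c (scl (a n) (y n)) + scl d (scl (b n) (y n)))"
        by (intro suminf_add bounded_linear.summable[OF scl.bounded_linear_right] summ ab)
      also have "\<dots> = \<Phi> (\<lambda>n. c * a n + d * b n)"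
        unfolding \<Phi>_def by (simp add: scl.add_left)
      finally have "scl c u + scl d v = \<Phi> (\<lambda>n. c * a n + d * b n)" .
      moreover have "(\<lambda>n. c * a n + d * b n) \<in> A"
        unfolding A_def unit_l1_ball_def
      proof (intro CollectI allI)
        fix n
        have "(\<Sum>k<n. norm (c * a k + d * b k)) \<le> (\<Sum>k<n. norm c * norm (a k) + norm d * norm (b k))"
          by (intro sum_mono order.trans[OF norm_triangle_ineq]) (simp add: norm_mult)
        also have "\<dots> = norm c * (\<Sum>k<n. norm (a k)) + norm d * (\<Sum>k<n. norm (b k))"
          by (simp add: sum.distrib sum_distrib_left)
        also have "\<dots> \<le> norm c * 1 + norm d * 1"
          using ab(1,2) by (intro add_mono mult_left_mono) (auto simp: A_def unit_l1_ball_def)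
        finally show "(\<Sum>k<n. norm (c * a k + d * b k)) \<le> 1" using cd by simp
      qed
      ultimately show "scl c u + scl d v \<in> \<Phi> ` A" by blast
    qed
  next
    show "range y \<subseteq> \<Phi> ` A"
    proof
      fix u assume "u \<in> range y"
      then obtain k where k: "u = y k" by blast
      define a where "a n = (if n = k then 1 else 0 :: 'k)" for n
      have "(\<Sum>n<m. norm (a n)) \<le> 1" for m
      proof -
        have "(\<Sum>n<m. norm (a n)) = (\<Sum>n<m. if n = k then 1 else 0)"
          by (intro sum.cong) (auto simp: a_def)
        then show ?thesis by (simp add: sum.delta)
      qed
      then have "a \<in> A" by (simp add: A_def unit_l1_ball_def)
      moreover have "(\<lambda>n. scl (a n) (y n)) sums y k"
        using sums_single[of k y] by (rule sums_cong[THEN iffD1, rotated]) (auto simp: a_def)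
      then have "\<Phi> a = y k" unfolding \<Phi>_def by (rule sums_unique[symmetric])
      ultimately show "u \<in> \<Phi> ` A" using k by force
    qed
  qed
qed

lemma mackey_limit_uniform:
  assumes "limitin (mackey_topology scl) \<phi> f sequentially"
    and "compactin (weak_topology scl) K" "absolutely_convex scl K" "0 < e"
  shows "f \<in> dual scl" and "\<forall>\<^sub>F n in sequentially. \<forall>x\<in>K. norm (\<phi> n x - f x) < e"
proof -
  have "f \<in> topspace (mackey_topology scl)" using assms(1) by (rule limitin_topspace)
  then show f: "f \<in> dual scl" by (auto simp: mackey_topology_def)
  define W where "W = {g \<in> dual scl. \<forall>x\<in>K. norm (blinfun_apply g x - blinfun_apply f x) < e}"
  have "openin (mackey_topology scl) W"
    unfolding mackey_topology_def W_def using f assms(2-4)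
    by (intro topology_generated_by_Basis) blast
  moreover have "f \<in> W" using f assms(4) by (simp add: W_def)
  ultimately have "\<forall>\<^sub>F n in sequentially. \<phi> n \<in> W" using assms(1) by (auto simp: limitin_def)
  then show "\<forall>\<^sub>F n in sequentially. \<forall>x\<in>K. norm (\<phi> n x - f x) < e"
    by (rule eventually_mono) (simp add: W_def)
qed

lemma almost_norming_vector:
  fixes g :: "'a::real_normed_vector \<Rightarrow>\<^sub>L 'b::real_normed_vector"
  assumes "c < norm g" "0 \<le> c"
  obtains x where "norm x \<le> 1" "c < norm (g x)"
proof -
  obtain x where x: "c * norm x < norm (g x)"
    using norm_blinfun_bound[of c g] assms by (meson not_less)
  then have "x \<noteq> 0" by auto
  show thesis
  proof (rule that)
    show "norm (inverse (norm x) *\<^sub>R x) \<le> 1" using \<open>x \<noteq> 0\<close> by simp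
    show "c < norm (g (inverse (norm x) *\<^sub>R x))"
      using x \<open>x \<noteq> 0\<close> by (simp add: blinfun.scaleR_right field_simps)
  qed
qed

theorem sequentially_reflexive_if_no_l1:
  fixes scl :: "'k::{real_normed_field,euclidean_space} \<Rightarrow> 'a::banach \<Rightarrow> 'a"
  assumes ns: "normed_space_over scl" and no_l1: "\<not> l1_isomorphic_to_subspace scl"
  shows "sequentially_reflexive scl"
  unfolding sequentially_reflexive_def
proof (intro allI impI)
  fix \<phi> :: "nat \<Rightarrow> 'a \<Rightarrow>\<^sub>L 'k"
  assume \<phi>: "range \<phi> \<subseteq> dual scl" and "\<exists>f. limitin (mackey_topology scl) \<phi> f sequentially"
  then obtain f where lim: "limitin (mackey_topology scl) \<phi> f sequentially" by blast
  define g where "g n = \<phi> n - f" for n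
  have unif: "\<forall>\<^sub>F n in sequentially. \<forall>k. norm (g n (y k)) < e"
    if y: "\<And>k. norm (y k) \<le> C" "\<And>F. F \<in> dual scl \<Longrightarrow> (\<lambda>k. F (y k)) \<longlonglongrightarrow> 0" and e: "0 < e" for y C e
  proof -
    obtain K where K: "compactin (weak_topology scl) K" "absolutely_convex scl K" "range y \<subseteq> K"
      by (rule weakly_null_hull[OF ns y], assumption) (rule that)
    from mackey_limit_uniform(2)[OF lim K(1,2) e] show ?thesis
      by (rule eventually_mono) (use K(3) in \<open>auto simp: g_def blinfun.diff_left\<close>)
  qed
  have f: "f \<in> dual scl"
  proof -
    obtain K where K: "compactin (weak_topology scl) K" "absolutely_convex scl K"
      using weakly_null_hull[OF ns, of "\<lambda>_. 0" 0] by (auto simp: blinfun.zero_right)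
    from mackey_limit_uniform(1)[OF lim this zero_less_one] show ?thesis .
  qed
  have pointwise: "(\<lambda>n. g n x) \<longlonglongrightarrow> 0" for x
    unfolding tendsto_iff
  proof (intro allI impI)
    fix e :: real assume "0 < e"
    have "\<forall>\<^sub>F n in sequentially. \<forall>k. norm (g n ((\<lambda>k::nat. if k = 0 then x else 0) k)) < e"
    proof (rule unif[of _ "norm x"])
      show "(\<lambda>k. F (if k = 0 then x else 0)) \<longlonglongrightarrow> 0" for F :: "'a \<Rightarrow>\<^sub>L 'k"
        by (rule tendsto_eventually, rule eventually_sequentiallyI[of 1]) (simp add: blinfun.zero_right)
    qed (use \<open>0 < e\<close> in auto)
    then show "\<forall>\<^sub>F n in sequentially. dist (g n x) 0 < e"
      by (rule eventually_mono) (metis dist_0_norm dist_commute)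
  qed
  have "\<phi> \<longlonglongrightarrow> f"
  proof (rule ccontr)
    assume "\<not> \<phi> \<longlonglongrightarrow> f"
    then obtain e where e: "0 < e" "\<not> (\<forall>\<^sub>F n in sequentially. norm (g n) < e)"
      by (auto simp: tendsto_iff g_def dist_norm)
    then have "\<exists>\<^sub>\<infinity>n. e \<le> norm (g n)"
      by (simp add: not_eventually not_less cofinite_eq_sequentially)
    then obtain r1 :: "nat \<Rightarrow> nat" where r1: "strict_mono r1" "\<And>n. e \<le> norm (g (r1 n))"
      using greedy_subsequence[of "\<lambda>_ n. e \<le> norm (g n)"] by blast
    have "\<forall>n. \<exists>x. norm x \<le> 1 \<and> e / 2 < norm (g (r1 n) x)"
    proof
      fix n
      have "e / 2 < norm (g (r1 n))" using e(1) r1(2)[of n] by simp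
      then show "\<exists>x. norm x \<le> 1 \<and> e / 2 < norm (g (r1 n) x)"
        using almost_norming_vector[of "e / 2" "g (r1 n)"] e(1) by (metis half_gt_zero less_imp_le)
    qed
    then obtain x where x: "\<And>n. norm (x n) \<le> 1" "\<And>n. e / 2 < norm (g (r1 n) (x n))" by metis
    have "\<exists>r2 :: nat \<Rightarrow> nat. strict_mono r2 \<and> (\<forall>F\<in>dual scl. convergent (\<lambda>n. F (x (r2 n))))"
    proof (rule ccontr)
      assume "\<not> ?thesis"
      then have osc: "\<exists>F\<in>dual scl. \<not> convergent (\<lambda>n. F (x (r n)))" if "strict_mono r" for r :: "nat \<Rightarrow> nat"
        using that by blast
      show False
      proof (rule rosenthal_dor[OF ns x(1) osc], assumption)
        fix v and \<kappa> :: real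
        assume *: "0 < \<kappa>" "\<And>n. norm (v n) \<le> 1"
          "\<And>(c :: nat \<Rightarrow> 'k) n. \<kappa> * (\<Sum>j<n. norm (c j)) \<le> norm (\<Sum>j<n. scl (c j) (v j))"
        from l1_isomorphicI[OF ns *] no_l1 show False by contradiction
      qed
    qed
    then obtain r2 :: "nat \<Rightarrow> nat" where r2: "strict_mono r2"
      "\<And>F. F \<in> dual scl \<Longrightarrow> convergent (\<lambda>n. F (x (r2 n)))" by blast
    define G where "G n = g (r1 (r2 n))" for n
    define u where "u n = x (r2 n)" for n
    have sub: "strict_mono (\<lambda>n. r1 (r2 n))" using strict_mono_o[OF r1(1) r2(1)] by (simp add: o_def)
    define Q where "Q M n \<longleftrightarrow> (\<forall>m\<in>M. norm (G n (u m)) < e / 4)" for M n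
    have "\<exists>\<^sub>\<infinity>n. Q M n" if M: "finite M" for M
    proof -
      have "\<forall>\<^sub>F n in sequentially. norm (G n (u m)) < e / 4" for m
        using tendstoD[OF LIMSEQ_subseq_LIMSEQ[OF pointwise[of "u m"] sub], of "e / 4"] e(1)
        by (simp add: G_def o_def)
      then have "\<forall>\<^sub>F n in sequentially. Q M n" unfolding Q_def using M by (simp add: eventually_ball_finite)
      then show ?thesis by (simp add: eventually_frequently cofinite_eq_sequentially)
    qed
    then obtain l :: "nat \<Rightarrow> nat" where l: "strict_mono l" "\<And>n. Q (l ` {..<n}) (l n)"
      using greedy_subsequence[of Q] by blast
    define y where "y k = u (l (Suc k)) - u (l k)" for k
    have big: "e / 4 < norm (G (l (Suc k)) (y k))" for k
    proof -
      have "norm (G (l (Suc k)) (u (l k))) < e / 4" using l(2)[of "Suc k"] by (simp add: Q_def)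
      moreover have "e / 2 < norm (G (l (Suc k)) (u (l (Suc k))))"
        using x(2)[of "r2 (l (Suc k))"] unfolding G_def u_def .
      ultimately show ?thesis
        using norm_triangle_ineq2[of "G (l (Suc k)) (u (l (Suc k)))" "G (l (Suc k)) (u (l k))"]
        by (simp add: y_def blinfun.diff_right)
    qed
    have "\<forall>\<^sub>F n in sequentially. \<forall>k. norm (g n (y k)) < e / 4"
    proof (rule unif[of y 2])
      show "norm (y k) \<le> 2" for k
        using norm_triangle_ineq4[of "u (l (Suc k))" "u (l k)"] x(1)[of "r2 (l (Suc k))"] x(1)[of "r2 (l k)"]
        by (simp add: y_def u_def)
      fix F assume "F \<in> dual scl"
      then obtain L where "(\<lambda>n. F (u n)) \<longlonglongrightarrow> L" using r2(2) by (auto simp: convergent_def u_def)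
      then have L: "(\<lambda>n. F (u (l n))) \<longlonglongrightarrow> L"
        using LIMSEQ_subseq_LIMSEQ[OF _ l(1)] by (force simp: o_def)
      from tendsto_diff[OF LIMSEQ_Suc[OF L] L] show "(\<lambda>k. F (y k)) \<longlonglongrightarrow> 0"
        by (simp add: y_def blinfun.diff_right)
    qed (use e(1) in simp)
    then obtain N where N: "\<And>n k. n \<ge> N \<Longrightarrow> norm (g n (y k)) < e / 4"
      by (auto simp: eventually_sequentially)
    have "r1 (r2 (l (Suc N))) \<ge> N"
      using seq_suble[OF strict_mono_o[OF sub l(1)], of "Suc N"] by (simp add: o_def)
    from N[OF this, of N] big[of N] show False by (simp add: G_def)
  qed
  with f show "\<exists>g\<in>dual scl. \<phi> \<longlonglongrightarrow> g" by blast
qed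

section \<open>Weakly compact sets are sequentially compact\<close>

lemma continuous_map_weak_dual:
  assumes "F \<in> dual scl"
  shows "continuous_map (weak_topology scl) euclidean (blinfun_apply F)"
proof -
  have top: "topspace (weak_topology scl) = UNIV"
  proof -
    have "UNIV \<in> {blinfun_apply f -` U |f U. f \<in> dual scl \<and> open U}"
      using assms by (auto intro!: exI[of _ F] exI[of _ UNIV])
    then show ?thesis unfolding weak_topology_def topology_generated_by_topspace by blast
  qed
  have "openin (weak_topology scl) (blinfun_apply F -` U)" if "open U" for U
    unfolding weak_topology_def using assms that by (intro topology_generated_by_Basis) blast
  then show ?thesis by (auto simp: continuous_map_def top vimage_def)
qed

lemma continuous_map_weak_real:
  fixes scl :: "'k::{real_normed_field,euclidean_space} \<Rightarrow> 'a::real_normed_vector \<Rightarrow> 'a"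
    and g :: "'a \<Rightarrow>\<^sub>L real"
  assumes "normed_space_over scl"
  shows "continuous_map (weak_topology scl) euclidean (blinfun_apply g)"
proof -
  interpret normed_space_over scl by fact
  obtain F where F: "F \<in> dual scl" "\<And>c x. inner c (F x) = g (scl (conjugate c) x)"
    "norm F \<le> norm g"
    by (rule dual_from_real_functional[OF assms, of g]) (rule that)
  have "conjugate 1 = (1 :: 'k)" by (simp add: conjugate_def)
  then have "g x = inner 1 (F x)" for x using F(2)[of 1 x] by simp
  then have "blinfun_apply g = (\<lambda>k. inner 1 k) \<circ> blinfun_apply F" by (simp add: fun_eq_iff)
  moreover have "continuous_map euclidean euclidean (\<lambda>k. inner (1 :: 'k) k)"
    by (simp add: continuous_on_inner)
  ultimately show ?thesis
    using continuous_map_compose[OF continuous_map_weak_dual[OF F(1)]] by metis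
qed

lemma compactin_cluster_point:
  fixes x :: "nat \<Rightarrow> 'a"
  assumes K: "compactin X K" and x: "\<And>n. x n \<in> K"
  obtains z where "z \<in> K" "\<And>W. openin X W \<Longrightarrow> z \<in> W \<Longrightarrow> \<exists>\<^sub>\<infinity>n. x n \<in> W"
proof (rule ccontr)
  assume not_thesis: "\<not> thesis"
  note conclude = that
  have "\<exists>W. openin X W \<and> z \<in> W \<and> \<not> (\<exists>\<^sub>\<infinity>n. x n \<in> W)" if "z \<in> K" for z
    using not_thesis conclude[OF that] by blast
  then obtain W where W: "\<And>z. z \<in> K \<Longrightarrow> openin X (W z)" "\<And>z. z \<in> K \<Longrightarrow> z \<in> W z"
    "\<And>z. z \<in> K \<Longrightarrow> \<not> (\<exists>\<^sub>\<infinity>n. x n \<in> W z)"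
    by metis
  have "\<exists>\<F>. finite \<F> \<and> \<F> \<subseteq> W ` K \<and> K \<subseteq> \<Union>\<F>"
  proof (rule compactinD[OF K])
    show "openin X U" if "U \<in> W ` K" for U using that W(1) by blast
    show "K \<subseteq> \<Union> (W ` K)" using W(2) by blast
  qed
  then obtain \<F> where \<F>: "finite \<F>" "\<F> \<subseteq> W ` K" "K \<subseteq> \<Union>\<F>" by blast
  have "\<forall>\<^sub>\<infinity>n. \<forall>U\<in>\<F>. x n \<notin> U"
    using \<F>(2) W(3) by (intro eventually_ball_finite[OF \<F>(1)]) (auto simp: not_frequently)
  then obtain n where "\<forall>U\<in>\<F>. x n \<notin> U" by (auto simp: MOST_nat_le)
  with x[of n] \<F>(3) show False by blast
qed

primrec rational_combination :: "(nat \<Rightarrow> 'a::real_vector) \<Rightarrow> (rat \<times> nat) list \<Rightarrow> 'a" where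
  "rational_combination x [] = 0"
| "rational_combination x (p # l) = of_rat (fst p) *\<^sub>R x (snd p) + rational_combination x l"

lemma rational_combination_dense:
  fixes x :: "nat \<Rightarrow> 'a::real_normed_vector"
  assumes "v \<in> span (range x)" "0 < e"
  shows "\<exists>l. norm (v - rational_combination x l) < e"
proof -
  have "\<forall>e>0. \<exists>l. norm (v - rational_combination x l) < e"
    using assms(1)
  proof (induction rule: span_induct_alt)
    case base
    show ?case by (auto intro!: exI[of _ "[]"])
  next
    case (step c a b)
    show ?case
    proof (intro allI impI)
      fix e :: real assume e: "0 < e"
      obtain i where i: "a = x i" using step(1) by blast
      obtain l where l: "norm (b - rational_combination x l) < e / 2" using step(2) e by (meson half_gt_zero)
      define \<delta> where "\<delta> = e / (2 * (norm a + 1))"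
      have \<delta>: "0 < \<delta>" "\<delta> * norm a \<le> e / 2" using e by (auto simp: \<delta>_def field_simps add_pos_nonneg)
      obtain t where t: "c < of_rat t" "of_rat t < c + \<delta>" using of_rat_dense[of c "c + \<delta>"] \<delta>(1) by auto
      have "norm ((c - of_rat t) *\<^sub>R a) \<le> \<delta> * norm a"
        unfolding norm_scaleR using t by (intro mult_right_mono) auto
      moreover have "c *\<^sub>R a + b - rational_combination x ((t, i) # l)
          = (c - of_rat t) *\<^sub>R a + (b - rational_combination x l)"
        by (simp add: i algebra_simps)
      ultimately have "norm (c *\<^sub>R a + b - rational_combination x ((t, i) # l)) < e"
        using norm_triangle_ineq[of "(c - of_rat t) *\<^sub>R a" "b - rational_combination x l"] l \<delta>(2)
        by (simp only:)
      then show "\<exists>l. norm (c *\<^sub>R a + b - rational_combination x l) < e" by blast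
    qed
  qed
  with assms(2) show ?thesis by blast
qed

text \<open>
  One half of the Eberlein-Smulian theorem. Countably many functionals norm the rational combinations
  of the \<open>x n\<close>, and a diagonal sequence makes all of them converge along \<open>x\<close>. A weak cluster point of a
  subsequence lies in the closed span of the \<open>x n\<close>, and the functionals, whose values at it are known,
  separate the points of that closed span. So there is only one cluster point, and by compactness the
  diagonal sequence converges weakly to it.
\<close>

theorem weakly_compact_imp_sequentially_compact:
  fixes scl :: "'k::{real_normed_field,euclidean_space} \<Rightarrow> 'a::real_normed_vector \<Rightarrow> 'a"
  assumes ns: "normed_space_over scl" and K: "compactin (weak_topology scl) K" and x: "\<And>n. x n \<in> K"
  obtains z and r :: "nat \<Rightarrow> nat" where "z \<in> K" "strict_mono r"
    "\<And>g :: 'a \<Rightarrow>\<^sub>L real. (\<lambda>n. g (x (r n))) \<longlonglongrightarrow> g z"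
proof -
  have bdd: "bounded (range (\<lambda>n. g (x n)))" for g :: "'a \<Rightarrow>\<^sub>L real"
  proof -
    have "compactin euclidean (blinfun_apply g ` K)"
      by (rule image_compactin[OF K continuous_map_weak_real[OF ns]])
    then have "bounded (blinfun_apply g ` K)" by (simp add: compact_imp_bounded)
    then show ?thesis by (rule bounded_subset) (use x in auto)
  qed
  have cluster: "\<exists>z\<in>K. \<forall>(g :: 'a \<Rightarrow>\<^sub>L real) e. 0 < e \<longrightarrow> (\<exists>\<^sub>\<infinity>n. \<bar>g (x (s n)) - g z\<bar> < e)" for s :: "nat \<Rightarrow> nat"
  proof -
    obtain z where z: "z \<in> K" "\<And>W. openin (weak_topology scl) W \<Longrightarrow> z \<in> W \<Longrightarrow> \<exists>\<^sub>\<infinity>n. x (s n) \<in> W"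
      using compactin_cluster_point[OF K, of "\<lambda>n. x (s n)"] x by blast
    have "\<exists>\<^sub>\<infinity>n. \<bar>g (x (s n)) - g z\<bar> < e" if "0 < e" for e and g :: "'a \<Rightarrow>\<^sub>L real"
    proof -
      let ?W = "{y \<in> topspace (weak_topology scl). g y \<in> ball (g z) e}"
      have "openin (weak_topology scl) ?W"
        by (rule openin_continuous_map_preimage[OF continuous_map_weak_real[OF ns]]) simp
      moreover have "z \<in> ?W" using z(1) compactin_subset_topspace[OF K] that by auto
      ultimately have "\<exists>\<^sub>\<infinity>n. x (s n) \<in> ?W" by (rule z(2))
      then show ?thesis by (rule frequently_elim1) (auto simp: dist_real_def)
    qed
    with z(1) show ?thesis by blast
  qed
  have "\<forall>l. \<exists>h :: 'a \<Rightarrow>\<^sub>L real. blinfun_apply h (rational_combination x l) = norm (rational_combination x l) \<and> norm h \<le> 1"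
    using norming_functional[of "rational_combination x _"] by blast
  then obtain h :: "(rat \<times> nat) list \<Rightarrow> 'a \<Rightarrow>\<^sub>L real" where
    h: "\<And>l. h l (rational_combination x l) = norm (rational_combination x l)" "\<And>l. norm (h l) \<le> 1"
    by metis
  define hn where "hn n = h (from_nat n)" for n
  define P where "P n s \<longleftrightarrow> convergent (\<lambda>k. hn n (x (s k)))" for n and s :: "nat \<Rightarrow> nat"
  interpret subseqs P
  proof
    fix n and s :: "nat \<Rightarrow> nat"
    have "bounded (range (\<lambda>k. hn n (x (s k))))" by (rule bounded_subset[OF bdd[of "hn n"]]) auto
    then obtain L r where "strict_mono r" "((\<lambda>k. hn n (x (s k))) \<circ> r) \<longlonglongrightarrow> L"
      using bounded_imp_convergent_subsequence by blast
    then show "\<exists>r. strict_mono r \<and> P n (s \<circ> r)" by (auto simp: P_def convergent_def o_def)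
  qed
  have "convergent (\<lambda>k. hn n (x (diagseq k)))" for n
  proof -
    have "P n (diagseq \<circ> (+) (Suc n))"
    proof (rule diagseq_holds)
      fix r s :: "nat \<Rightarrow> nat" and n
      assume "strict_mono r" "P n s"
      then show "P n (s \<circ> r)"
        using convergent_subseq_convergent[of "\<lambda>k. hn n (x (s k))" r] by (simp add: P_def o_def)
    qed
    then show ?thesis
      using convergent_ignore_initial_segment[of "\<lambda>k. hn n (x (diagseq k))" "Suc n"]
      by (simp add: P_def o_def add.commute)
  qed
  then obtain L where L: "\<And>n. (\<lambda>k. hn n (x (diagseq k))) \<longlonglongrightarrow> L n"
    unfolding convergent_def by metis
  have L_eq: "h l z = L (to_nat l)" if s: "strict_mono s"
    and z: "\<And>(g :: 'a \<Rightarrow>\<^sub>L real) e. 0 < e \<Longrightarrow> \<exists>\<^sub>\<infinity>n. \<bar>g (x (diagseq (s n))) - g z\<bar> < e" for s :: "nat \<Rightarrow> nat" and z l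
  proof (rule ccontr)
    assume "h l z \<noteq> L (to_nat l)"
    then have e: "0 < \<bar>h l z - L (to_nat l)\<bar> / 2" (is "0 < ?e") by simp
    have "\<forall>\<^sub>F n in sequentially. \<bar>h l (x (diagseq (s n))) - L (to_nat l)\<bar> < ?e"
      using tendstoD[OF LIMSEQ_subseq_LIMSEQ[OF L[of "to_nat l"] s] e]
      by (simp add: o_def hn_def dist_real_def)
    then have "\<forall>\<^sub>\<infinity>n. \<bar>h l (x (diagseq (s n))) - L (to_nat l)\<bar> < ?e"
      by (simp add: cofinite_eq_sequentially)
    from frequently_eventually_conj[OF z[OF e, of "h l"] this]
    obtain n where n: "\<bar>h l (x (diagseq (s n))) - L (to_nat l)\<bar> < ?e"
        "\<bar>h l (x (diagseq (s n))) - h l z\<bar> < ?e"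
      by (auto dest: frequently_ex)
    have le: "\<bar>h l z - L (to_nat l)\<bar> \<le>
        \<bar>h l (x (diagseq (s n))) - L (to_nat l)\<bar> + \<bar>h l (x (diagseq (s n))) - h l z\<bar>" by linarith
    have "\<bar>h l (x (diagseq (s n))) - L (to_nat l)\<bar> + \<bar>h l (x (diagseq (s n))) - h l z\<bar>
        < \<bar>h l z - L (to_nat l)\<bar>"
      using add_strict_mono[OF n] by (simp only: field_sum_of_halves)
    with leD[OF le] show False by contradiction
  qed
  have near: "\<exists>w\<in>span (range x). norm (z - w) < e" if e: "0 < e"
    and z: "\<And>(g :: 'a \<Rightarrow>\<^sub>L real) e. 0 < e \<Longrightarrow> \<exists>\<^sub>\<infinity>n. \<bar>g (x (diagseq (s n))) - g z\<bar> < e" for s :: "nat \<Rightarrow> nat" and z e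
  proof (rule ccontr)
    assume "\<not> ?thesis"
    then have "\<And>w. w \<in> span (range x) \<Longrightarrow> e \<le> norm (z - w)" by (auto simp: not_less)
    then obtain g :: "'a \<Rightarrow>\<^sub>L real" where g: "\<And>w. w \<in> span (range x) \<Longrightarrow> g w = 0" "g z \<noteq> 0"
      using functional_separating_from_subspace[OF subspace_span e] by metis
    have "g (x n) = 0" for n by (intro g(1) span_base) simp
    with z[of "\<bar>g z\<bar>" g] g(2) show False by simp
  qed
  have unique: "z' = z" if s: "strict_mono s" "strict_mono s'"
    and z: "\<And>(g :: 'a \<Rightarrow>\<^sub>L real) e. 0 < e \<Longrightarrow> \<exists>\<^sub>\<infinity>n. \<bar>g (x (diagseq (s n))) - g z\<bar> < e"
    and z': "\<And>(g :: 'a \<Rightarrow>\<^sub>L real) e. 0 < e \<Longrightarrow> \<exists>\<^sub>\<infinity>n. \<bar>g (x (diagseq (s' n))) - g z'\<bar> < e"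
    for s s' :: "nat \<Rightarrow> nat" and z z'
  proof (rule ccontr)
    define w where "w = z' - z"
    assume "z' \<noteq> z"
    then have e: "0 < norm w / 8" (is "0 < ?e") by (simp add: w_def)
    obtain p where p: "p \<in> span (range x)" "norm (z - p) < ?e" using near[OF e z] by blast
    obtain p' where p': "p' \<in> span (range x)" "norm (z' - p') < ?e" using near[OF e z'] by blast
    obtain l where l: "norm ((p' - p) - rational_combination x l) < ?e"
      using rational_combination_dense[OF span_diff[OF p'(1) p(1)] e] by blast
    have "w - rational_combination x l = (z' - p') - (z - p) + ((p' - p) - rational_combination x l)"
      by (simp add: w_def)
    then have close: "norm (w - rational_combination x l) < 3 * ?e"
      using norm_triangle_ineq[of "(z' - p') - (z - p)" "(p' - p) - rational_combination x l"]
        norm_triangle_ineq4[of "z' - p'" "z - p"] p(2) p'(2) l by simp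
    have "h l w = 0" using L_eq[OF s(1) z, of l] L_eq[OF s(2) z', of l] by (simp add: w_def blinfun.diff_right)
    then have "norm (rational_combination x l) = h l (rational_combination x l - w)"
      by (simp add: blinfun.diff_right h(1))
    also have "\<dots> \<le> norm (h l) * norm (rational_combination x l - w)"
      using norm_blinfun[of "h l" "rational_combination x l - w"] by simp
    also have "\<dots> \<le> 1 * norm (rational_combination x l - w)"
      by (rule mult_right_mono[OF h(2)]) simp
    finally have "norm (rational_combination x l) < 3 * ?e"
      using close by (simp add: norm_minus_commute)
    with close norm_triangle_ineq[of "w - rational_combination x l" "rational_combination x l"] e
    show False by simp
  qed
  obtain z where z: "z \<in> K" "\<And>(g :: 'a \<Rightarrow>\<^sub>L real) e. 0 < e \<Longrightarrow> \<exists>\<^sub>\<infinity>n. \<bar>g (x (diagseq n)) - g z\<bar> < e"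
    using cluster[of diagseq] by blast
  show thesis
  proof (rule that[OF z(1) subseq_diagseq], rule ccontr)
    fix g :: "'a \<Rightarrow>\<^sub>L real"
    assume "\<not> (\<lambda>n. g (x (diagseq n))) \<longlonglongrightarrow> g z"
    then obtain e where e: "0 < e" "\<not> (\<forall>\<^sub>F n in sequentially. \<bar>g (x (diagseq n)) - g z\<bar> < e)"
      by (auto simp: tendsto_iff dist_real_def)
    then have "\<exists>\<^sub>\<infinity>n. e \<le> \<bar>g (x (diagseq n)) - g z\<bar>"
      by (simp add: not_eventually not_less cofinite_eq_sequentially)
    then obtain s :: "nat \<Rightarrow> nat" where s: "strict_mono s" "\<And>n. e \<le> \<bar>g (x (diagseq (s n))) - g z\<bar>"
      using greedy_subsequence[of "\<lambda>_ n. e \<le> \<bar>g (x (diagseq n)) - g z\<bar>"] by blast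
    obtain z' where z': "\<And>(g :: 'a \<Rightarrow>\<^sub>L real) e. 0 < e \<Longrightarrow> \<exists>\<^sub>\<infinity>n. \<bar>g (x (diagseq (s n))) - g z'\<bar> < e"
      using cluster[of "\<lambda>n. diagseq (s n)"] by blast
    have "z' = z" by (rule unique[of "\<lambda>n. n" s]) (use s z z' in \<open>auto simp: strict_mono_def\<close>)
    with z'[OF e(1), of g] s(2) show False by (simp add: not_le[symmetric])
  qed
qed

section \<open>Rademacher coefficients\<close>

text \<open>
  The Rademacher functions, a sequence of signs being coded by the set of positions of its minus signs.
\<close>

definition rad :: "nat set \<Rightarrow> nat \<Rightarrow> real" where
  "rad E n = (if n \<in> E then -1 else 1)"

definition sign_avg :: "nat \<Rightarrow> (nat set \<Rightarrow> real) \<Rightarrow> real" where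
  "sign_avg N h = (\<Sum>E\<in>Pow {..<N}. h E) / 2 ^ N"

lemma rad_sq [simp]: "rad E n * rad E n = 1" and abs_rad [simp]: "\<bar>rad E n\<bar> = 1"
  by (simp_all add: rad_def)

lemma sign_avg_const [simp]: "sign_avg N (\<lambda>_. c) = c"
  by (simp add: sign_avg_def card_Pow)

lemma sign_avg_add: "sign_avg N (\<lambda>E. g E + h E) = sign_avg N g + sign_avg N h"
  by (simp add: sign_avg_def sum.distrib add_divide_distrib)

lemma sign_avg_diff: "sign_avg N (\<lambda>E. g E - h E) = sign_avg N g - sign_avg N h"
  by (simp add: sign_avg_def sum_subtractf diff_divide_distrib)

lemma sign_avg_scale: "sign_avg N (\<lambda>E. c * h E) = c * sign_avg N h"
  by (simp add: sign_avg_def flip: sum_distrib_left)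

lemma sign_avg_sum: "sign_avg N (\<lambda>E. \<Sum>i\<in>I. h i E) = (\<Sum>i\<in>I. sign_avg N (h i))"
  unfolding sign_avg_def by (subst sum.swap) (simp add: sum_divide_distrib)

lemma sign_avg_mono: "(\<And>E. g E \<le> h E) \<Longrightarrow> sign_avg N g \<le> sign_avg N h"
  unfolding sign_avg_def by (intro divide_right_mono sum_mono) auto

lemma sign_avg_abs: "\<bar>sign_avg N h\<bar> \<le> sign_avg N (\<lambda>E. \<bar>h E\<bar>)"
  unfolding sign_avg_def by (simp add: divide_right_mono)

text \<open>
  Flipping the sign at position \<open>i\<close> changes the sign of the product.
\<close>

lemma sign_avg_rad_orthogonal:
  assumes "i < N" "j < N"
  shows "sign_avg N (\<lambda>E. rad E i * rad E j) = (if i = j then 1 else 0)"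
proof (cases "i = j")
  case False
  define flip where "flip E = (if i \<in> E then E - {i} else insert i E)" for E
  have flip: "flip (flip E) = E" "E \<in> Pow {..<N} \<Longrightarrow> flip E \<in> Pow {..<N}" for E
    using assms by (auto simp: flip_def)
  have "rad (flip E) i * rad (flip E) j = - (rad E i * rad E j)" for E
    using False by (auto simp: rad_def flip_def)
  then have "(\<Sum>E\<in>Pow {..<N}. rad E i * rad E j) = (\<Sum>E\<in>Pow {..<N}. - (rad E i * rad E j))"
    by (intro sum.reindex_bij_witness[of _ flip flip]) (use flip in \<open>simp_all\<close>)
  then show ?thesis using False by (simp add: sign_avg_def sum_negf)
qed simp

lemma bessel:
  assumes "M \<le> N"
  shows "(\<Sum>n<M. (sign_avg N (\<lambda>E. rad E n * h E))\<^sup>2) \<le> sign_avg N (\<lambda>E. (h E)\<^sup>2)"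
proof -
  define c where "c n = sign_avg N (\<lambda>E. rad E n * h E)" for n
  have expand: "(h E - (\<Sum>n<M. c n * rad E n))\<^sup>2 =
      (h E)\<^sup>2 - 2 * (\<Sum>n<M. c n * (rad E n * h E)) + (\<Sum>i<M. \<Sum>j<M. c i * c j * (rad E i * rad E j))" for E
  proof -
    have "(\<Sum>n<M. c n * rad E n)\<^sup>2 = (\<Sum>i<M. \<Sum>j<M. c i * c j * (rad E i * rad E j))"
      by (simp add: power2_eq_square sum_product mult_ac)
    moreover have "h E * (\<Sum>n<M. c n * rad E n) = (\<Sum>n<M. c n * (rad E n * h E))"
      by (simp add: sum_distrib_left mult_ac)
    ultimately show ?thesis by (simp add: power2_diff)
  qed
  have "0 \<le> sign_avg N (\<lambda>E. (h E - (\<Sum>n<M. c n * rad E n))\<^sup>2)"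
    unfolding sign_avg_def by (intro divide_nonneg_nonneg sum_nonneg) auto
  also have "\<dots> =
      sign_avg N (\<lambda>E. (h E)\<^sup>2) - 2 * (\<Sum>n<M. c n * c n) +
        (\<Sum>i<M. \<Sum>j<M. c i * c j * sign_avg N (\<lambda>E. rad E i * rad E j))"
    unfolding expand by (simp add: sign_avg_add sign_avg_diff sign_avg_scale sign_avg_sum c_def)
  also have "(\<Sum>i<M. \<Sum>j<M. c i * c j * sign_avg N (\<lambda>E. rad E i * rad E j)) =
      (\<Sum>i<M. \<Sum>j<M. if i = j then c i * c j else 0)"
    using assms by (intro sum.cong) (auto simp: sign_avg_rad_orthogonal)
  also have "\<dots> = (\<Sum>i<M. c i * c i)" by (intro sum.cong) auto
  finally show ?thesis by (simp add: c_def power2_eq_square)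
qed

lemma limitin_generatedI:
  assumes l: "l \<in> \<Union>S" and ev: "\<And>W. W \<in> S \<Longrightarrow> l \<in> W \<Longrightarrow> \<forall>\<^sub>F n in F. \<phi> n \<in> W"
  shows "limitin (topology_generated_by S) \<phi> l F"
  unfolding limitin_def
proof (intro conjI allI impI)
  show "l \<in> topspace (topology_generated_by S)" using l by simp
  fix U assume "openin (topology_generated_by S) U \<and> l \<in> U"
  then have "generate_topology_on S U" "l \<in> U" by (simp_all add: openin_topology_generated_by_iff)
  then show "\<forall>\<^sub>F n in F. \<phi> n \<in> U"
  proof induction
    case (Int a b)
    then show ?case by (simp add: eventually_conj_iff)
  next
    case (UN K)
    then obtain k where "k \<in> K" "l \<in> k" by blast
    with UN.IH have "\<forall>\<^sub>F n in F. \<phi> n \<in> k" by blast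
    then show ?case by (rule eventually_mono) (use \<open>k \<in> K\<close> in blast)
  qed (use ev in auto)
qed

text \<open>
  The functionals that an embedding of \<open>l1\<close> induces by the Hahn-Banach theorem, one for each sequence of
  signs, together with the ultrafilter that averages them.
\<close>

locale sign_functionals =
  fixes \<phi> :: "nat set \<Rightarrow> 'a::real_normed_vector \<Rightarrow>\<^sub>L real" and u :: "nat \<Rightarrow> 'a" and C :: real
    and U :: "nat filter"
  assumes C: "0 < C" and norm_\<phi>: "norm (\<phi> E) \<le> C" and \<phi>_u: "\<phi> E (u n) = rad E n"
    and U: "free_ultrafilter U"
begin

lemma U_ne: "U \<noteq> bot" and eventually_U: "eventually P sequentially \<Longrightarrow> eventually P U"
  using U by (auto simp: free_ultrafilter_def le_filter_def)

lemma \<phi>_le: "\<bar>\<phi> E x\<bar> \<le> C * norm x"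
  using order.trans[OF norm_blinfun[of "\<phi> E" x] mult_right_mono[OF norm_\<phi>]] by simp

definition coeff_avg :: "nat \<Rightarrow> nat \<Rightarrow> 'a \<Rightarrow> real" where
  "coeff_avg n N x = sign_avg N (\<lambda>E. rad E n * \<phi> E x)"

lemma linear_coeff_avg: "linear (coeff_avg n N)"
  by (rule linearI)
    (simp_all add: coeff_avg_def blinfun.add_right blinfun.scaleR_right distrib_left sign_avg_add
      mult.left_commute[of "rad _ _"] sign_avg_scale)

lemma coeff_avg_le: "\<bar>coeff_avg n N x\<bar> \<le> sign_avg N (\<lambda>E. \<bar>\<phi> E x\<bar>)"
  using sign_avg_abs[of N "\<lambda>E. rad E n * \<phi> E x"] by (simp add: coeff_avg_def abs_mult)

lemma coeff_avg_bound: "\<bar>coeff_avg n N x\<bar> \<le> C * norm x"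
  using order.trans[OF coeff_avg_le sign_avg_mono[of "\<lambda>E. \<bar>\<phi> E x\<bar>" "\<lambda>_. C * norm x"]] \<phi>_le by simp

lemma coeff_exists: "\<exists>f :: 'a \<Rightarrow>\<^sub>L real. \<forall>x. ((\<lambda>N. coeff_avg n N x) \<longlongrightarrow> f x) U"
  by (rule ultralimit_functional[of U "coeff_avg n" C]) (use U linear_coeff_avg coeff_avg_bound in blast)+

definition coeff :: "nat \<Rightarrow> 'a \<Rightarrow>\<^sub>L real" where
  "coeff n = (SOME f. \<forall>x. ((\<lambda>N. coeff_avg n N x) \<longlongrightarrow> blinfun_apply f x) U)"

lemma coeff: "((\<lambda>N. coeff_avg n N x) \<longlongrightarrow> coeff n x) U"
  using someI_ex[OF coeff_exists[of n]] unfolding coeff_def by blast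

lemma coeff_u: "coeff n (u n) = 1"
proof (rule tendsto_unique[OF U_ne coeff])
  have "coeff_avg n N (u n) = 1" for N by (simp add: coeff_avg_def \<phi>_u)
  then show "((\<lambda>N. coeff_avg n N (u n)) \<longlongrightarrow> 1) U" by simp
qed

lemma coeff_tendsto_0: "(\<lambda>n. coeff n x) \<longlonglongrightarrow> 0"
proof -
  have "(\<Sum>n<M. (coeff n x)\<^sup>2) \<le> (C * norm x)\<^sup>2" for M
  proof (rule tendsto_upperbound[OF _ _ U_ne])
    show "((\<lambda>N. \<Sum>n<M. (coeff_avg n N x)\<^sup>2) \<longlongrightarrow> (\<Sum>n<M. (coeff n x)\<^sup>2)) U"
      by (intro tendsto_sum tendsto_power coeff)
    have "(\<phi> E x)\<^sup>2 \<le> (C * norm x)\<^sup>2" for E using \<phi>_le[of E x] by (simp add: abs_le_square_iff[symmetric])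
    then have "sign_avg N (\<lambda>E. (\<phi> E x)\<^sup>2) \<le> (C * norm x)\<^sup>2" for N
      using sign_avg_mono[of "\<lambda>E. (\<phi> E x)\<^sup>2" "\<lambda>_. (C * norm x)\<^sup>2" N] by simp
    then have "(\<Sum>n<M. (coeff_avg n N x)\<^sup>2) \<le> (C * norm x)\<^sup>2" if "M \<le> N" for N
      using order.trans[OF bessel[OF that, of "\<lambda>E. \<phi> E x"]] by (simp add: coeff_avg_def)
    then show "\<forall>\<^sub>F N in U. (\<Sum>n<M. (coeff_avg n N x)\<^sup>2) \<le> (C * norm x)\<^sup>2"
      by (intro eventually_U eventually_sequentiallyI)
  qed
  then have "summable (\<lambda>n. (coeff n x)\<^sup>2)" by (intro summableI_nonneg_bounded) auto
  then have "(\<lambda>n. (coeff n x)\<^sup>2) \<longlonglongrightarrow> 0" by (rule summable_LIMSEQ_zero)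
  from tendsto_real_sqrt[OF this] show ?thesis by (simp add: tendsto_rabs_zero_iff)
qed

lemma sign_mean:
  obtains m where "mean m" "\<And>A. ((\<lambda>N. sign_avg N (indicator A)) \<longlongrightarrow> m A) U"
proof -
  have rng: "0 \<le> sign_avg N (indicator A)" "sign_avg N (indicator A) \<le> 1" for N A
    using sign_avg_mono[of "\<lambda>_. 0" "indicator A" N] sign_avg_mono[of "indicator A" "\<lambda>_. 1" N]
    by (simp_all add: indicator_def)
  have "\<exists>l. ((\<lambda>N. sign_avg N (indicator A)) \<longlongrightarrow> l) U" for A
    by (rule ultralimit_exists[OF U]) (use rng in \<open>auto intro!: boundedI[of _ 1]\<close>)
  then obtain m where m: "\<And>A. ((\<lambda>N. sign_avg N (indicator A)) \<longlongrightarrow> m A) U" by metis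
  have "mean m"
  proof
    show "0 \<le> m A" for A by (rule tendsto_lowerbound[OF m _ U_ne]) (simp add: rng)
    show "m UNIV \<le> 1" by (rule tendsto_upperbound[OF m _ U_ne]) (simp add: rng)
    fix A B :: "nat set set" assume AB: "A \<inter> B = {}"
    have "indicator (A \<union> B) = (\<lambda>E. indicator A E + indicator B E :: real)"
      using AB by (auto simp: indicator_def fun_eq_iff)
    then have "sign_avg N (indicator (A \<union> B)) = sign_avg N (indicator A) + sign_avg N (indicator B)" for N
      by (simp add: sign_avg_add)
    with m[of "A \<union> B"] have "((\<lambda>N. sign_avg N (indicator A) + sign_avg N (indicator B)) \<longlongrightarrow> m (A \<union> B)) U"
      by simp
    from tendsto_unique[OF U_ne this tendsto_add[OF m m]] show "m (A \<union> B) = m A + m B" .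
  qed
  with m show thesis by (intro that)
qed

text \<open>
  If \<open>coeff (n k) (y k)\<close> is at least \<open>e\<close>, then the mean of \<open>\<bar>\<phi> E (y k)\<bar>\<close> over \<open>E\<close> is at least \<open>e\<close>, and as
  these functions are uniformly bounded, they exceed \<open>e / 2\<close> on sets \<open>A k\<close> of mean bounded below. A
  subsequence of the \<open>A k\<close> has the finite intersection property. A limit of functionals \<open>\<phi> E\<close> with \<open>E\<close> in
  larger and larger finite intersections is then at least \<open>e / 2\<close> in absolute value at infinitely many
  \<open>y k\<close>.
\<close>

lemma coeff_weakly_null:
  assumes null: "\<And>g :: 'a \<Rightarrow>\<^sub>L real. (\<lambda>k. g (y k)) \<longlonglongrightarrow> 0" and e: "0 < e"
    and big: "\<And>k. e \<le> \<bar>coeff (n k) (y k)\<bar>"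
  shows False
proof -
  have "bounded (range y)"
  proof (rule weakly_bounded_imp_norm_bounded)
    show "bounded (range (\<lambda>k. g (y k)))" for g :: "'a \<Rightarrow>\<^sub>L real"
      using null[of g] convergent_imp_bounded by blast
  qed
  then obtain B where B: "0 < B" "\<And>k. norm (y k) \<le> B" by (auto simp: bounded_pos)
  define A where "A k = {E. e / 2 \<le> \<bar>\<phi> E (y k)\<bar>}" for k
  obtain m where m: "mean m" "\<And>A. ((\<lambda>N. sign_avg N (indicator A)) \<longlongrightarrow> m A) U"
    by (rule sign_mean) (rule that)
  interpret mean m by (rule m(1))
  have A_fat: "e / (2 * C * B) \<le> m (A k)" for k
  proof -
    have "\<bar>\<phi> E (y k)\<bar> \<le> e / 2 + C * B * indicator (A k) E" for E
    proof (cases "E \<in> A k")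
      case True
      have "\<bar>\<phi> E (y k)\<bar> \<le> C * norm (y k)" by (rule \<phi>_le)
      also have "\<dots> \<le> C * B" using C B(2) by (intro mult_left_mono) auto
      finally show ?thesis using True e by simp
    qed (simp add: A_def)
    then have "sign_avg N (\<lambda>E. \<bar>\<phi> E (y k)\<bar>) \<le> e / 2 + C * B * sign_avg N (indicator (A k))" for N
      using sign_avg_mono[of "\<lambda>E. \<bar>\<phi> E (y k)\<bar>" "\<lambda>E. e / 2 + C * B * indicator (A k) E" N]
      by (simp add: sign_avg_add sign_avg_scale)
    then have "\<bar>coeff_avg (n k) N (y k)\<bar> \<le> e / 2 + C * B * sign_avg N (indicator (A k))" for N
      using coeff_avg_le order.trans by blast
    then have "\<bar>coeff (n k) (y k)\<bar> \<le> e / 2 + C * B * m (A k)"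
      by (intro tendsto_le[OF U_ne tendsto_add[OF tendsto_const tendsto_mult_left[OF m(2)]]
            tendsto_rabs[OF coeff]]) simp
    with big[of k] have "e / 2 \<le> m (A k) * (C * B)" by (simp add: mult.commute)
    then show ?thesis using C B(1) by (simp add: field_simps)
  qed
  have "0 < e / (2 * C * B)" using e C B(1) by simp
  then obtain r :: "nat \<Rightarrow> nat" where r: "strict_mono r" "\<And>k. \<exists>E. \<forall>i<k. E \<in> A (r i)"
    by (rule subsequence_with_finite_intersections[OF _ A_fat]) (rule that)
  then obtain E where E: "\<And>k i. i < k \<Longrightarrow> E k \<in> A (r i)" by metis
  obtain \<psi> :: "'a \<Rightarrow>\<^sub>L real" where \<psi>: "\<And>x. ((\<lambda>k. \<phi> (E k) x) \<longlongrightarrow> \<psi> x) U"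
    by (rule ultralimit_functional[of U "\<lambda>k. blinfun_apply (\<phi> (E k))" C])
      (use U \<phi>_le in \<open>auto intro: blinfun.bounded_linear_right bounded_linear.linear\<close>)
  have "e / 2 \<le> \<bar>\<psi> (y (r i))\<bar>" for i
  proof (rule tendsto_lowerbound[OF tendsto_rabs[OF \<psi>] _ U_ne])
    have "e / 2 \<le> \<bar>\<phi> (E k) (y (r i))\<bar>" if "Suc i \<le> k" for k
      using E[of i k] that by (simp add: A_def)
    then show "\<forall>\<^sub>F k in U. e / 2 \<le> \<bar>\<phi> (E k) (y (r i))\<bar>"
      by (intro eventually_U eventually_sequentiallyI)
  qed
  moreover have "\<forall>\<^sub>F i in sequentially. \<bar>\<psi> (y (r i))\<bar> < e / 2"
    using tendstoD[OF LIMSEQ_subseq_LIMSEQ[OF null[of \<psi>] r(1)], of "e / 2"] e by (simp add: o_def)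
  ultimately show False by (auto simp: eventually_sequentially not_less[symmetric])
qed

text \<open>
  If not, subtract from points where the coefficients are large the weak limit of a subsequence. At
  the limit itself the coefficients tend to zero, so they are large along a weakly null sequence.
\<close>

lemma coeff_uniformly_null_on_weakly_compact:
  fixes scl :: "'k::{real_normed_field,euclidean_space} \<Rightarrow> 'a \<Rightarrow> 'a"
  assumes ns: "normed_space_over scl" and K: "compactin (weak_topology scl) K" and e: "0 < e"
  shows "\<forall>\<^sub>F n in sequentially. \<forall>x\<in>K. \<bar>coeff n x\<bar> < e"
proof (rule ccontr)
  assume "\<not> ?thesis"
  then have "\<exists>\<^sub>\<infinity>n. \<exists>x\<in>K. e \<le> \<bar>coeff n x\<bar>"
    by (simp add: not_eventually not_less cofinite_eq_sequentially)
  then obtain n :: "nat \<Rightarrow> nat" where n: "strict_mono n" "\<And>k. \<exists>x\<in>K. e \<le> \<bar>coeff (n k) x\<bar>"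
    using greedy_subsequence[of "\<lambda>_ n. \<exists>x\<in>K. e \<le> \<bar>coeff n x\<bar>"] by blast
  then obtain x where x: "\<And>k. x k \<in> K" "\<And>k. e \<le> \<bar>coeff (n k) (x k)\<bar>" by metis
  obtain z and r :: "nat \<Rightarrow> nat" where zr: "z \<in> K" "strict_mono r"
    "\<And>g :: 'a \<Rightarrow>\<^sub>L real. (\<lambda>k. g (x (r k))) \<longlonglongrightarrow> g z"
    by (rule weakly_compact_imp_sequentially_compact[OF ns K x(1)]) (rule that)
  have "(\<lambda>k. coeff (n (r k)) z) \<longlonglongrightarrow> 0"
    using LIMSEQ_subseq_LIMSEQ[OF coeff_tendsto_0[of z] strict_mono_o[OF n(1) zr(2)]] by (simp add: o_def)
  from tendstoD[OF this, of "e / 2"] e obtain k0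
    where k0: "\<And>k. k \<ge> k0 \<Longrightarrow> \<bar>coeff (n (r k)) z\<bar> < e / 2"
    by (auto simp: eventually_sequentially)
  show False
  proof (rule coeff_weakly_null[of "\<lambda>k. x (r (k + k0)) - z" "e / 2" "\<lambda>k. n (r (k + k0))"])
    show "(\<lambda>k. g (x (r (k + k0)) - z)) \<longlonglongrightarrow> 0" for g :: "'a \<Rightarrow>\<^sub>L real"
      using LIMSEQ_ignore_initial_segment[OF zr(3)[of g], of k0]
      by (simp add: blinfun.diff_right LIM_zero)
    show "e / 2 \<le> \<bar>coeff (n (r (k + k0))) (x (r (k + k0)) - z)\<bar>" for k
      using x(2)[of "r (k + k0)"] k0[of "k + k0"]
        abs_triangle_ineq2[of "coeff (n (r (k + k0))) (x (r (k + k0)))" "coeff (n (r (k + k0))) z"]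
      unfolding blinfun.diff_right by linarith
  qed (use e in simp)
qed

end

section \<open>Spaces with a copy of the space of absolutely summable sequences\<close>

text \<open>
  A basic neighbourhood of 0 may be centred at some \<open>h\<close> other than 0. As \<open>\<bar>h\<bar>\<close> attains its maximum on the
  weakly compact set, the strict inequality leaves room for a uniform error. Passing from the real parts
  \<open>f n\<close> to \<open>F n\<close> rotates the argument, which an absolutely convex set permits.
\<close>

lemma mackey_null_of_coefficients:
  fixes scl :: "'k::{real_normed_field,euclidean_space} \<Rightarrow> 'a::real_normed_vector \<Rightarrow> 'a"
    and f :: "nat \<Rightarrow> 'a \<Rightarrow>\<^sub>L real"
  assumes ns: "normed_space_over scl"
    and F: "\<And>n. F n \<in> dual scl" "\<And>n c x. inner c (F n x) = f n (scl (conjugate c) x)"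
    and f: "\<And>K e. compactin (weak_topology scl) K \<Longrightarrow> 0 < e \<Longrightarrow>
      \<forall>\<^sub>F n in sequentially. \<forall>x\<in>K. \<bar>f n x\<bar> < e"
  shows "limitin (mackey_topology scl) F 0 sequentially"
  unfolding mackey_topology_def
proof (rule limitin_generatedI)
  interpret normed_space_over scl by fact
  have zero: "0 \<in> dual scl" by (simp add: dual_def)
  define W where "W h K e = {g \<in> dual scl. \<forall>x\<in>K. norm (blinfun_apply g x - blinfun_apply h x) < e}" for h K e
  have "0 \<in> W 0 {} 1" using zero by (simp add: W_def)
  moreover have "compactin (weak_topology scl) {}" "absolutely_convex scl {}"
    by (simp_all add: absolutely_convex_def)
  ultimately show "0 \<in> \<Union> {W h K e | h K e. h \<in> dual scl \<and> compactin (weak_topology scl) K \<and>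
      absolutely_convex scl K \<and> 0 < e}"
    using zero zero_less_one by blast
  fix V assume "V \<in> {W h K e | h K e. h \<in> dual scl \<and> compactin (weak_topology scl) K \<and>
      absolutely_convex scl K \<and> 0 < e}" and V0: "0 \<in> V"
  then obtain h K and e :: real where V: "V = W h K e" and h: "h \<in> dual scl"
    and K: "compactin (weak_topology scl) K" "absolutely_convex scl K" and e: "0 < e" by blast
  have h_lt: "norm (h x) < e" if "x \<in> K" for x
    using V0 that by (auto simp: V W_def)
  have "\<exists>d>0. \<forall>x\<in>K. norm (h x) \<le> e - d"
  proof (cases "K = {}")
    case True
    then show ?thesis by (intro exI[of _ 1]) simp
  next
    case False
    have "compactin euclidean (blinfun_apply h ` K)"
      by (rule image_compactin[OF K(1) continuous_map_weak_dual[OF h]])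
    then have "compact (blinfun_apply h ` K)" by simp
    then obtain x0 where x0: "x0 \<in> K" "\<And>x. x \<in> K \<Longrightarrow> norm (h x) \<le> norm (h x0)"
      using continuous_attains_sup[of "blinfun_apply h ` K" norm] False
        continuous_on_norm[OF continuous_on_id] by auto
    then show ?thesis using h_lt[OF x0(1)] by (intro exI[of _ "e - norm (h x0)"]) simp
  qed
  then obtain d where d: "0 < d" "\<And>x. x \<in> K \<Longrightarrow> norm (h x) \<le> e - d" by blast
  define N where "N = real DIM('k)"
  have N: "0 < N" by (simp add: N_def)
  have rotate: "scl (conjugate b) x \<in> K" if "x \<in> K" "b \<in> Basis" for b x
  proof -
    have "norm (conjugate b) + norm (0 :: 'k) \<le> 1" using that(2) by simp
    then have "scl (conjugate b) x + scl 0 x \<in> K"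
      using K(2) that(1) unfolding absolutely_convex_def by blast
    then show ?thesis by simp
  qed
  have "\<forall>\<^sub>F n in sequentially. \<forall>x\<in>K. \<bar>f n x\<bar> < d / N" using d N by (intro f K) simp
  then show "\<forall>\<^sub>F n in sequentially. F n \<in> V"
  proof (rule eventually_mono)
    fix n assume n: "\<forall>x\<in>K. \<bar>f n x\<bar> < d / N"
    have "norm (F n x - h x) < e" if x: "x \<in> K" for x
    proof -
      have "norm (F n x) \<le> (\<Sum>b\<in>Basis. \<bar>inner (F n x) b\<bar>)" by (rule norm_le_l1)
      also have "\<dots> = (\<Sum>b\<in>Basis. \<bar>f n (scl (conjugate b) x)\<bar>)"
        using F(2)[of _ n x] by (simp add: inner_commute)
      also have "\<dots> < (\<Sum>b\<in>(Basis :: 'k set). d / N)"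
        using n rotate[OF x] by (intro sum_strict_mono) auto
      also have "\<dots> = d" by (simp add: N_def)
      finally show ?thesis using d(2)[OF x] norm_triangle_ineq4[of "F n x" "h x"] by simp
    qed
    then show "F n \<in> V" using F(1) by (simp add: V W_def)
  qed
qed

lift_definition l1_unit :: "nat \<Rightarrow> 'k::real_normed_field l1" is "\<lambda>n k. if k = n then 1 else 0"
proof -
  fix n :: nat
  have "(\<lambda>k. norm (if k = n then 1 else 0 :: 'k)) = (\<lambda>k. if k = n then 1 else 0)" by auto
  then show "summable (\<lambda>k. norm (if k = n then 1 else 0 :: 'k))" by simp
qed

lemma l1_embedding_lower_bound:
  assumes T: "bounded_linear (T :: 'k::real_normed_field l1 \<Rightarrow> 'a::real_normed_vector)"
    and S: "homeomorphism UNIV (range T) T S"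
  obtains c where "0 < c" "\<And>a. c * norm a \<le> norm (T a)"
proof -
  interpret T: bounded_linear T by fact
  have ST: "S (T a) = a" for a using S by (simp add: homeomorphism_def)
  have "continuous_on (range T) S" using S by (simp add: homeomorphism_def)
  then obtain d where d: "0 < d" "\<And>y. y \<in> range T \<Longrightarrow> dist y 0 < d \<Longrightarrow> dist (S y) (S 0) < 1"
    unfolding continuous_on_iff using T.zero by (metis rangeI zero_less_one)
  have small: "norm a < 1" if "norm (T a) < d" for a
    using d(2)[of "T a"] that ST[of 0] ST[of a] by (simp add: T.zero)
  have "d * norm a \<le> norm (T a)" for a
  proof (cases "a = 0")
    case False
    have "d \<le> norm (T (inverse (norm a) *\<^sub>R a))"
      using small[of "inverse (norm a) *\<^sub>R a"] False by (force simp: not_less[symmetric])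
    then show ?thesis using False by (simp add: T.scaleR field_simps)
  qed simp
  with d(1) show thesis by (rule that)
qed

theorem no_l1_if_sequentially_reflexive:
  fixes scl :: "'k::{real_normed_field,euclidean_space} \<Rightarrow> 'a::real_normed_vector \<Rightarrow> 'a"
  assumes ns: "normed_space_over scl" and reflexive: "sequentially_reflexive scl"
  shows "\<not> l1_isomorphic_to_subspace scl"
proof
  assume "l1_isomorphic_to_subspace scl"
  then obtain T :: "'k l1 \<Rightarrow> 'a" and S where T: "bounded_linear T" and S: "homeomorphism UNIV (range T) T S"
    unfolding l1_isomorphic_to_subspace_def by blast
  interpret T: bounded_linear T by fact
  obtain c where c: "0 < c" "\<And>a. c * norm a \<le> norm (T a)" by (rule l1_embedding_lower_bound[OF T S]) (rule that)
  have ST: "S (T a) = a" for a using S by (simp add: homeomorphism_def)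
  define u where "u n = T (l1_unit n)" for n
  define s where "s E a = (\<Sum>n. rad E n * inner 1 (l1_nth a n))" for E and a :: "'k l1"
  have le: "norm (rad E n * inner 1 (l1_nth a n)) \<le> norm (l1_nth a n)" for E n and a :: "'k l1"
    using Cauchy_Schwarz_ineq2[of 1 "l1_nth a n"] by (simp add: abs_mult)
  have summ: "summable (\<lambda>n. rad E n * inner 1 (l1_nth a n))" for E and a :: "'k l1"
    by (rule summable_comparison_test'[OF summable_l1 le])
  have s_add: "s E (a + b) = s E a + s E b" for E a b
    unfolding s_def by (simp add: plus_l1.rep_eq inner_add_right distrib_left suminf_add[OF summ summ])
  have s_scale: "s E (r *\<^sub>R a) = r * s E a" for E r a
    unfolding s_def
    by (simp add: scaleR_l1.rep_eq mult.left_commute[of "rad _ _" r] suminf_mult[OF summ])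
  have s_le: "\<bar>s E a\<bar> \<le> norm a" for E a
    unfolding s_def norm_l1.rep_eq real_norm_def[symmetric] by (rule norm_suminf_le[OF le summable_l1])
  have s_unit: "s E (l1_unit n) = rad E n" for E n
  proof -
    have "(\<lambda>k. rad E k * inner 1 (l1_nth (l1_unit n :: 'k l1) k)) = (\<lambda>k. if k = n then rad E k else 0)"
      by (auto simp: l1_unit.rep_eq dot_square_norm)
    then show ?thesis unfolding s_def using sums_unique[OF sums_single[of n "rad E"]] by simp
  qed
  have "\<exists>\<phi> :: 'a \<Rightarrow>\<^sub>L real. norm \<phi> \<le> inverse c \<and> (\<forall>n. blinfun_apply \<phi> (u n) = rad E n)" for E
  proof -
    obtain \<phi> :: "'a \<Rightarrow>\<^sub>L real" where \<phi>: "\<And>y. y \<in> range T \<Longrightarrow> \<phi> y = s E (S y)" "norm \<phi> \<le> inverse c"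
    proof (rule hahn_banach_norm[of "range T" "\<lambda>y. s E (S y)" "inverse c"])
      show "subspace (range T)"
        using linear_subspace_image[OF T.linear subspace_UNIV] .
      show "s E (S (y + z)) = s E (S y) + s E (S z)" if "y \<in> range T" "z \<in> range T" for y z
        using that by (auto simp: ST s_add simp flip: T.add)
      show "s E (S (r *\<^sub>R y)) = r * s E (S y)" if "y \<in> range T" for r y
        using that by (auto simp: ST s_scale simp flip: T.scaleR)
      show "s E (S y) \<le> inverse c * norm y" if y: "y \<in> range T" for y
      proof -
        obtain a where a: "y = T a" using y by blast
        have "s E a \<le> norm a" using s_le[of E a] by simp
        also have "\<dots> \<le> inverse c * norm (T a)" using c by (simp add: field_simps)
        finally show ?thesis by (simp add: a ST)
      qed
      show "0 \<le> inverse c" using c(1) by simp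
    qed (rule that)
    have "\<phi> (u n) = rad E n" for n using \<phi>(1)[of "u n"] by (simp add: u_def ST s_unit)
    with \<phi>(2) show ?thesis by blast
  qed
  then obtain \<phi> :: "nat set \<Rightarrow> 'a \<Rightarrow>\<^sub>L real"
    where \<phi>: "\<And>E. norm (\<phi> E) \<le> inverse c" "\<And>E n. \<phi> E (u n) = rad E n" by metis
  obtain U where U: "free_ultrafilter U" using free_ultrafilter_exists by blast
  interpret sign_functionals \<phi> u "inverse c" U
    by unfold_locales (use c(1) \<phi> U in simp_all)
  have "\<exists>F\<in>dual scl. \<forall>c x. inner c (blinfun_apply F x) = coeff n (scl (conjugate c) x)" for n
    by (rule dual_from_real_functional[OF ns, of "coeff n"]) blast
  then obtain F where F: "\<And>n. F n \<in> dual scl"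
    "\<And>n c x. inner c (blinfun_apply (F n) x) = coeff n (scl (conjugate c) x)" by metis
  have "limitin (mackey_topology scl) F 0 sequentially"
    by (rule mackey_null_of_coefficients[OF ns F]) (rule coeff_uniformly_null_on_weakly_compact[OF ns])
  with reflexive F(1) obtain g where g: "F \<longlonglongrightarrow> g"
    unfolding sequentially_reflexive_def by blast
  have "g x = 0" for x
  proof -
    have "inner c (g x) = 0" for c
    proof (rule LIMSEQ_unique)
      show "(\<lambda>n. inner c (F n x)) \<longlonglongrightarrow> inner c (g x)"
        by (intro tendsto_inner tendsto_const blinfun.tendsto[OF g])
      show "(\<lambda>n. inner c (F n x)) \<longlonglongrightarrow> 0"
        unfolding F(2) by (rule coeff_tendsto_0)
    qed
    from this[of "g x"] show ?thesis by simp
  qed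
  then have "g = 0" by (simp add: blinfun_eqI)
  with g have "(\<lambda>n. norm (F n)) \<longlonglongrightarrow> 0" by (simp add: tendsto_norm_zero)
  obtain M where M: "0 < M" "\<And>a. norm (T a) \<le> norm a * M" using T.pos_bounded by blast
  have "norm (l1_unit n :: 'k l1) = 1" for n
  proof -
    have "(\<lambda>k. norm (l1_nth (l1_unit n :: 'k l1) k)) = (\<lambda>k. if k = n then 1 else 0)"
      by (auto simp: l1_unit.rep_eq)
    then show ?thesis unfolding norm_l1.rep_eq using sums_unique[OF sums_single[of n "\<lambda>_. 1 :: real"]] by simp
  qed
  then have u_le: "norm (u n) \<le> M" for n using M(2)[of "l1_unit n"] by (simp add: u_def)
  have "1 \<le> norm (F n) * M" for n
  proof -
    interpret normed_space_over scl by fact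
    have "conjugate 1 = (1 :: 'k)" by (simp add: conjugate_def)
    then have "1 = inner 1 (F n (u n))" by (simp add: F(2) coeff_u)
    also have "\<dots> \<le> norm (1 :: 'k) * norm (F n (u n))" by (rule norm_cauchy_schwarz)
    also have "\<dots> \<le> norm (F n) * norm (u n)" by (simp add: norm_blinfun)
    also have "\<dots> \<le> norm (F n) * M" by (rule mult_left_mono[OF u_le]) simp
    finally show ?thesis .
  qed
  moreover have "(\<lambda>n. norm (F n) * M) \<longlonglongrightarrow> 0 * M"
    by (intro tendsto_mult tendsto_const) fact
  ultimately have "1 \<le> 0 * M" by (intro LIMSEQ_le_const) auto
  then show False by simp
qed

lemma normed_space_over_scaleR: "normed_space_over (scaleR :: real \<Rightarrow> 'a::real_normed_vector \<Rightarrow> 'a)"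
  by unfold_locales (simp_all add: scaleR_add_right scaleR_add_left)

theorem mainTheorem1:
  fixes scaleC :: "complex \<Rightarrow> 'b::banach \<Rightarrow> 'b"
  assumes "normed_space_over scaleC"
  shows "(sequentially_reflexive (scaleR :: real \<Rightarrow> 'a::banach \<Rightarrow> 'a) \<longleftrightarrow>
            \<not> l1_isomorphic_to_subspace (scaleR :: real \<Rightarrow> 'a \<Rightarrow> 'a)) \<and>
         (sequentially_reflexive scaleC \<longleftrightarrow> \<not> l1_isomorphic_to_subspace scaleC)"
  using sequentially_reflexive_if_no_l1[OF normed_space_over_scaleR]
    no_l1_if_sequentially_reflexive[OF normed_space_over_scaleR]
    sequentially_reflexive_if_no_l1[OF assms] no_l1_if_sequentially_reflexive[OF assms]
  by blast

end
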